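(* Let $a\ge 2$ be a fixed integer and let $\{\psi_n\}_{n\ge 0}$ be the generalized Walsh system of order $a$. Then there exists a double series $$\sum_{n,k=1}^\infty c_{n,k}\psi_n(x)\psi_k(y)\qquad\text{with}\qquad \sum_{n,k=1}^\infty |c_{n,k}|^q<\infty\ \text{ for all } q>2,$$ with the following property: for every number $\varepsilon>0$ there exists a measurable weight function $\mu:T=[0,1]^2\to(0,1]$ satisfying $$0<\mu(x,y)\le 1,\qquad \bigl|\{(x,y)\in T:\ \mu(x,y)\neq 1\}\bigr|<\varepsilon,$$ such that the series is universal in $L^1_\mu(T)$ concerning rearrangements with respect to convergence in the sense of both spherical and rectangular partial sums.
   Context: Generalized Walsh system. Let $a\ge2$ be an integer and $\omega_a=e^{2\pi i/a}$. The Rademacher functions of order $a$ are defined by $\varphi_0(x)=\omega_a^k$ if $x\in[\frac ka,\frac{k+1}a)$, $k=0,1,\dots,a-1$, extended to $\mathbb R$ with period $1$, and $\varphi_n(x)=\varphi_0(a^nx)$ for $n\ge 0$. The generalized Walsh system of order $a$ is defined by $\psi_0(x)=1$ and, if $n=\alpha_1a^{n_1}+\dots+\alpha_sa^{n_s}$ with integers $n_1>\dots>n_s\ge 0$ and $\alpha_j\in\{1,\dots,a-1\}$ (the base-$a$ expansion of $n\ge1$), by $\psi_n(x)=\varphi_{n_1}(x)^{\alpha_1}\cdots\varphi_{n_s}(x)^{\alpha_s}$. The functions $\psi_n$ are in general complex valued, and coefficients are complex numbers. Notation. $T=[0,1]^2$ and $|\cdot|$ applied to sets denotes Lebesgue measure.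 For a measurable $\mu:T\to(0,1]$, $L^1_\mu(T)$ is the space of real measurable functions $f$ on $T$ with $\iint_T|f(x,y)|\mu(x,y)\,dx\,dy<\infty$; convergence to $f$ in $L^1_\mu(T)$ of (possibly complex-valued) functions $g_j$ means $\iint_T|g_j-f|\,\mu\,dx\,dy\to0$. Partial sums. For a double series $\sum_{k,\nu=1}^\infty g_{k,\nu}$ of functions on $T$ the rectangular partial sums are $S_{n,m}=\sum_{k=1}^n\sum_{\nu=1}^m g_{k,\nu}$ and the spherical partial sums are $S_R=\sum_{k,\nu\ge1,\ k^2+\nu^2\le R^2}g_{k,\nu}$. Convergence in the sense of rectangular partial sums means convergence of $S_{n,m}$ as $\min\{n,m\}\to\infty$; convergence in the sense of spherical partial sums means convergence of $S_R$ as $R\to\infty$. Universality concerning rearrangements. The double series with terms $g_{n,k}(x,y)=c_{n,k}\psi_n(x)\psi_k(y)$, $n,k\ge1$, is universal in $L^1_\mu(T)$ concerning rearrangements with respect to convergence in the sense of both spherical and rectangular partial sums if for every $f\in L^1_\mu(T)$ the members of the series can be rearranged, i.e. there is a bijection $\sigma$ of $\{1,2,\dots\}^2$ onto itself, so that the obtained double series $\sum_{n,k=1}^\infty g_{\sigma(n,k)}$ converges to $f$ in $L^1_\mu(T)$ both in the sense of spherical partial sums and in the sense of rectangular partial sums. *)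

theory Defs
  imports "HOL-Analysis.Analysis"
begin

section \<open>The generalized Walsh system of order \<open>a\<close>\<close>

text \<open>For \<open>x \<in> [k/a, (k+1)/a)\<close> with \<open>k < a\<close> we have \<open>k = \<lfloor>a x\<rfloor>\<close>;
  \<open>frac\<close> provides the extension with period 1.\<close>

definition rademacher0 :: "nat \<Rightarrow> real \<Rightarrow> complex" where
  "rademacher0 a x = exp (2 * of_real pi * \<i> / of_nat a) ^ nat \<lfloor>real a * frac x\<rfloor>"

definition rademacher :: "nat \<Rightarrow> nat \<Rightarrow> real \<Rightarrow> complex" where
  "rademacher a n x = rademacher0 a (real a ^ n * x)"

definition digit :: "nat \<Rightarrow> nat \<Rightarrow> nat \<Rightarrow> nat" where
  "digit a n j = (n div a ^ j) mod a"

text \<open>The product ranges over the finitely many positions of nonzero base-\<open>a\<close> digits of \<open>n\<close>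
  (finite if \<open>a \<ge> 2\<close>); lemma \<open>walsh_expansion\<close> below gives the usual form.\<close>

definition walsh :: "nat \<Rightarrow> nat \<Rightarrow> real \<Rightarrow> complex" where
  "walsh a n x = (\<Prod>j | digit a n j \<noteq> 0. rademacher a j x ^ digit a n j)"

lemma rademacher0_interval:
  assumes "k < a" "real k / real a \<le> x" "x < (real k + 1) / real a"
  shows "rademacher0 a x = exp (2 * of_real pi * \<i> / of_nat a) ^ k"
proof -
  have a: "real a > 0" using assms(1) by simp
  have "0 \<le> x" using assms(2) by (rule order_trans[rotated]) simp
  moreover have "(real k + 1) / real a \<le> 1" using assms(1) a by (simp add: field_simps)
  then have "x < 1" using assms(3) by linarith
  ultimately have "frac x = x" by (simp add: frac_eq)
  moreover have "\<lfloor>real a * x\<rfloor> = int k"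
    using assms a by (intro floor_unique) (auto simp: field_simps)
  ultimately show ?thesis by (simp add: rademacher0_def)
qed

lemma finite_digits: "finite {j. digit a n j \<noteq> 0}" if "2 \<le> a"
proof (rule finite_subset)
  show "{j. digit a n j \<noteq> 0} \<subseteq> {..n}"
  proof
    fix j assume "j \<in> {j. digit a n j \<noteq> 0}"
    then have "n div a ^ j \<noteq> 0" by (intro notI) (simp add: digit_def)
    then have "a ^ j \<le> n" by (meson div_less not_le)
    moreover have "j < 2 ^ j" by (rule less_exp)
    moreover have "(2::nat) ^ j \<le> a ^ j" using that by (intro power_mono) auto
    ultimately have "j \<le> n" by linarith
    then show "j \<in> {..n}" by simp
  qed
qed simp

lemma digit_sum:
  assumes "\<And>i. b i < a"
  shows "digit a (\<Sum>i<N. b i * a ^ i) j = (if j < N then b j else 0)"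
  using assms
proof (induction j arbitrary: b N)
  case 0
  show ?case
  proof (cases N)
    case (Suc M)
    have "(\<Sum>i<N. b i * a ^ i) = b 0 + a * (\<Sum>i<M. b (Suc i) * a ^ i)"
      unfolding Suc sum.lessThan_Suc_shift by (simp add: sum_distrib_left mult_ac)
    then show ?thesis using Suc 0 by (simp add: digit_def)
  qed (simp add: digit_def)
next
  case (Suc j)
  show ?case
  proof (cases N)
    case (Suc M)
    have "(\<Sum>i<N. b i * a ^ i) = b 0 + a * (\<Sum>i<M. b (Suc i) * a ^ i)"
      unfolding Suc sum.lessThan_Suc_shift by (simp add: sum_distrib_left mult_ac)
    moreover have "b 0 < a" by (rule Suc.prems)
    ultimately have "(\<Sum>i<N. b i * a ^ i) div a = (\<Sum>i<M. b (Suc i) * a ^ i)"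
      by simp
    then have "digit a (\<Sum>i<N. b i * a ^ i) (Suc j) = digit a (\<Sum>i<M. b (Suc i) * a ^ i) j"
      by (simp add: digit_def div_mult2_eq)
    also have "\<dots> = (if j < M then b (Suc j) else 0)"
      using Suc.prems by (rule Suc.IH[of "\<lambda>i. b (Suc i)"])
    finally show ?thesis using Suc by simp
  qed (simp add: digit_def)
qed

lemma walsh_expansion:
  assumes "finite I" "\<And>i. i \<in> I \<Longrightarrow> 0 < \<alpha> i \<and> \<alpha> i < a" "2 \<le> a"
  shows "walsh a (\<Sum>i\<in>I. \<alpha> i * a ^ i) x = (\<Prod>i\<in>I. rademacher a i x ^ \<alpha> i)"
proof -
  obtain N where N: "I \<subseteq> {..<N}" using finite_nat_iff_bounded assms(1) by blast
  define b where "b i = (if i \<in> I then \<alpha> i else 0)" for i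
  have "(\<Sum>i\<in>I. \<alpha> i * a ^ i) = (\<Sum>i<N. b i * a ^ i)"
    by (rule sum.mono_neutral_cong_left) (use N in \<open>auto simp: b_def\<close>)
  moreover have "b i < a" for i using assms by (auto simp: b_def)
  ultimately have d: "digit a (\<Sum>i\<in>I. \<alpha> i * a ^ i) j = b j" for j
    using N by (auto simp: digit_sum b_def)
  have "{j. b j \<noteq> 0} = I" using assms(2) by (auto simp: b_def)
  then show ?thesis unfolding walsh_def d by (intro prod.cong) (auto simp: b_def)
qed

lemma walsh_0: "walsh a 0 x = 1"
  by (simp add: walsh_def digit_def)


section \<open>Weighted \<open>L\<^sup>1\<close> spaces on the unit square\<close>

definition unit_square :: "(real \<times> real) set" where
  "unit_square = {0..1} \<times> {0..1}"

definition weighted_L1 :: "(real \<times> real \<Rightarrow> real) \<Rightarrow> (real \<times> real \<Rightarrow> real) set" where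
  "weighted_L1 \<mu> = {f \<in> borel_measurable (lebesgue_on unit_square).
     (\<integral>\<^sup>+ p. ennreal (\<bar>f p\<bar> * \<mu> p) \<partial>lebesgue_on unit_square) < \<infinity>}"

definition tendsto_weighted_L1 ::
  "(real \<times> real \<Rightarrow> real) \<Rightarrow> ('i \<Rightarrow> real \<times> real \<Rightarrow> complex) \<Rightarrow> (real \<times> real \<Rightarrow> real) \<Rightarrow> 'i filter \<Rightarrow> bool"
where
  "tendsto_weighted_L1 \<mu> g f F \<longleftrightarrow>
     ((\<lambda>j. \<integral>\<^sup>+ p. ennreal (cmod (g j p - of_real (f p)) * \<mu> p) \<partial>lebesgue_on unit_square) \<longlongrightarrow> 0) F"


section \<open>Double series and their rearrangements\<close>

definition pos_pairs :: "(nat \<times> nat) set" where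
  "pos_pairs = {1..} \<times> {1..}"

definition rect_sum :: "(nat \<times> nat \<Rightarrow> real \<times> real \<Rightarrow> complex) \<Rightarrow> nat \<times> nat \<Rightarrow> real \<times> real \<Rightarrow> complex" where
  "rect_sum g = (\<lambda>(n, m) p. \<Sum>k=1..n. \<Sum>\<nu>=1..m. g (k, \<nu>) p)"

definition disc_indices :: "real \<Rightarrow> (nat \<times> nat) set" where
  "disc_indices R = {(k, \<nu>) \<in> pos_pairs. real k ^ 2 + real \<nu> ^ 2 \<le> R ^ 2}"

definition spherical_sum :: "(nat \<times> nat \<Rightarrow> real \<times> real \<Rightarrow> complex) \<Rightarrow> real \<Rightarrow> real \<times> real \<Rightarrow> complex" where
  "spherical_sum g R p = (\<Sum>i\<in>disc_indices R. g i p)"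

lemma finite_disc_indices: "finite (disc_indices R)"
proof (rule finite_subset)
  show "disc_indices R \<subseteq> {..nat \<lfloor>\<bar>R\<bar>\<rfloor>} \<times> {..nat \<lfloor>\<bar>R\<bar>\<rfloor>}"
  proof (clarsimp simp: disc_indices_def)
    fix k \<nu> :: nat assume *: "real k ^ 2 + real \<nu> ^ 2 \<le> R ^ 2"
    have "real k ^ 2 \<le> R ^ 2" "real \<nu> ^ 2 \<le> R ^ 2"
      using * zero_le_power2[of "real k"] zero_le_power2[of "real \<nu>"] by linarith+
    then have "real k \<le> \<bar>R\<bar>" "real \<nu> \<le> \<bar>R\<bar>"
      by (metis abs_le_square_iff abs_of_nat)+
    then show "k \<le> nat \<lfloor>\<bar>R\<bar>\<rfloor> \<and> \<nu> \<le> nat \<lfloor>\<bar>R\<bar>\<rfloor>" by (simp add: le_nat_floor)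
  qed
qed simp

text \<open>Convergence of \<open>S\<^bsub>n,m\<^esub>\<close> as \<open>min {n, m} \<rightarrow> \<infinity>\<close> is convergence along the product filter.\<close>

definition universal_rearrangement ::
  "(real \<times> real \<Rightarrow> real) \<Rightarrow> (nat \<times> nat \<Rightarrow> real \<times> real \<Rightarrow> complex) \<Rightarrow> bool"
where
  "universal_rearrangement \<mu> g \<longleftrightarrow>
     (\<forall>f \<in> weighted_L1 \<mu>. \<exists>\<sigma>. bij_betw \<sigma> pos_pairs pos_pairs \<and>
        tendsto_weighted_L1 \<mu> (spherical_sum (g \<circ> \<sigma>)) f at_top \<and>
        tendsto_weighted_L1 \<mu> (rect_sum (g \<circ> \<sigma>)) f (sequentially \<times>\<^sub>F sequentially))"

definition walsh_term :: "nat \<Rightarrow> (nat \<times> nat \<Rightarrow> complex) \<Rightarrow> nat \<times> nat \<Rightarrow> real \<times> real \<Rightarrow> complex" where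
  "walsh_term a c = (\<lambda>(n, k) (x, y). c (n, k) * walsh a n x * walsh a k y)"

end

theory Submission
  imports Defs "HOL-Library.Function_Algebras"
begin

text \<open>The series carries its nonzero terms in blocks, one for each function of a countable dense family of
step functions. Since the coefficients may vanish, and do vanish on an infinite set of indices, a double
series can be rearranged by putting the terms of any chosen single series on the diagonal of
the grid and zero terms elsewhere. Both the rectangular sum over \<open>{1..n} \<times> {1..m}\<close> and the spherical
sum of radius \<open>R\<close> are then ordinary partial sums of the single series, of lengths \<open>min n m\<close> and
\<open>\<lfloor>\<bar>R\<bar> / \<surd>2\<rfloor>\<close> (\<open>diagonal_rearrangement\<close>). So the problem is one of ordering a countable family of
terms so that its partial sums converge to a given function.

Such an ordering exists (\<open>rearrangement_of_blocks\<close>) as soon as the terms tend to zero in norm and every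
function is approximated by blocks lying outside any given finite set of indices, the partial sums of
the block being bounded by the norm of that function up to a small error. One places the first
unused term, then a block that approximates the remaining difference, and repeats. The
remainders tend to zero, hence so do the oscillations within the blocks.

The blocks are built cell by cell. On a cell of side \<open>a\<^sup>-\<^sup>m\<close> the indicator is a Walsh polynomial with indices
below \<open>a\<^sup>m\<close>. It is multiplied, in each of the two variables, by \<open>1 - D(a\<^sup>M x)\<close>, where \<open>D = \<Sum>j<a\<^sup>s. \<psi>\<^sub>j\<close> equals
\<open>a\<^sup>s\<close> on \<open>[0, a\<^sup>-\<^sup>s)\<close> and zero on the rest of the period. This changes it only on a fraction of at most \<open>2 a\<^sup>-\<^sup>s\<close> of the
cell, while both frequencies become at least \<open>a\<^sup>M\<close> and so avoid any finite set
(\<open>spike_polynomial_1\<close>, \<open>spike_polynomial_2\<close>).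
All coefficients of this polynomial have modulus at most \<open>a\<^sup>-\<^sup>2\<^sup>m\<close>, and there are at most
\<open>a\<^sup>2\<^sup>(\<^sup>m\<^sup>+\<^sup>s\<^sup>)\<close> of them. A block is the concatenation of the polynomials of all \<open>a\<^sup>2\<^sup>m\<close> cells. A partial sum
of it consists of the finished cells, which reproduce the step function, and a part of one unfinished
polynomial, whose \<open>L\<^sup>1\<close> norm is at most its \<open>L\<^sup>2\<close> norm and so, by orthonormality, of order \<open>a\<^sup>s\<^sup>-\<^sup>m\<close>. For
fixed \<open>s\<close> the sum of the squares of all coefficients in the block stays bounded as \<open>m\<close> grows while the
coefficients tend to zero, so that the sum of their \<open>(2+\<delta>)\<close>-th powers tends to zero
(\<open>step_block\<close>). This is the reason for the range \<open>q > 2\<close>.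

The exceptional sets of the blocks have summable measures, so almost every point lies in
finitely many of them. A weight that equals 1 off the exceptional sets of large index, and is so
small on each of them that the corresponding block contributes next to nothing there
(\<open>weight_exists\<close>), turns the bounds off the exceptional sets into bounds in the weighted norm.\<close>

section \<open>Walsh functions and the cells of the base-\<open>a\<close> subdivision\<close>

text \<open>Numbers the interval of length \<open>a\<^sup>-\<^sup>m\<close> that contains \<open>x\<close> modulo 1, so that cells are
periodic like the Walsh functions and step functions are defined at every point.\<close>

definition cell :: "nat \<Rightarrow> nat \<Rightarrow> real \<Rightarrow> nat" where
  "cell a m x = nat \<lfloor>real a ^ m * frac x\<rfloor>"

lemma rademacher0_cell: "rademacher0 a x = exp (2 * of_real pi * \<i> / of_nat a) ^ cell a 1 x"
  by (simp add: rademacher0_def cell_def)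

lemma digit_Suc: "d < a \<Longrightarrow> digit a (d + a * n) (Suc j) = digit a n j"
  by (simp add: digit_def div_mult2_eq)

lemma digit_0: "d < a \<Longrightarrow> digit a (d + a * n) 0 = d"
  by (simp add: digit_def)

lemma walsh_prod:
  assumes "\<And>j. K \<le> j \<Longrightarrow> digit a n j = 0"
  shows "walsh a n x = (\<Prod>j<K. rademacher a j x ^ digit a n j)"
  unfolding walsh_def
proof (rule prod.mono_neutral_left)
  show "{j. digit a n j \<noteq> 0} \<subseteq> {..<K}" using assms by (auto intro: leI ccontr)
qed auto

text \<open>The system is self-similar: the lowest digit of the index contributes a power of the zeroth Rademacher
function, and the other digits a Walsh function of \<open>a x\<close>. The kernel formula and orthogonality rest on inductions
along this recursion.\<close>

lemma walsh_step:
  assumes "2 \<le> a" "d < a"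
  shows "walsh a (d + a * n) x = rademacher0 a x ^ d * walsh a n (real a * x)"
proof -
  obtain K where K: "\<And>j. K \<le> j \<Longrightarrow> digit a n j = 0"
    using finite_digits[OF assms(1), of n] unfolding finite_nat_iff_bounded
    by (metis (mono_tags) lessThan_iff mem_Collect_eq not_le subset_iff)
  have K': "digit a (d + a * n) j = 0" if "Suc K \<le> j" for j
    using that K assms by (cases j) (auto simp: digit_Suc)
  have "rademacher a (Suc j) x = rademacher a j (real a * x)" for j
    by (simp add: rademacher_def mult_ac)
  moreover have "rademacher a 0 x = rademacher0 a x"
    by (simp add: rademacher_def)
  ultimately show ?thesis
    using assms walsh_prod[of "Suc K" a "d + a * n" x, OF K'] walsh_prod[of K a n "real a * x", OF K]
    by (simp add: prod.lessThan_Suc_shift digit_Suc digit_0 del: prod.lessThan_Suc)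
qed

lemma nat_base_cases:
  fixes n a :: nat assumes "2 \<le> a"
  obtains d k where "n = d + a * k" "d < a"
  by (rule that[of "n mod a" "n div a"]) (use assms in auto)

lemma walsh_induct [consumes 1, case_names zero step]:
  fixes n a :: nat
  assumes a: "2 \<le> a" and z: "P 0" and s: "\<And>d n. d < a \<Longrightarrow> P n \<Longrightarrow> P (d + a * n)"
  shows "P n"
proof (induction n rule: less_induct)
  case (less n)
  obtain d k where n: "n = d + a * k" "d < a" by (rule nat_base_cases[OF a])
  show ?case
  proof (cases "k = 0")
    case True
    then show ?thesis using s[OF n(2) z] n by simp
  next
    case False
    then have "k < a * k" using a by simp
    then have "k < n" unfolding n(1) by (rule trans_less_add2)
    then show ?thesis using less s n by blast
  qed
qed

lemma frac_add_1: "frac (x + 1) = frac (x::real)"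
  by (simp add: frac_def)

lemma rademacher0_frac: "frac x = frac y \<Longrightarrow> rademacher0 a x = rademacher0 a y"
  by (simp add: rademacher0_def)

lemma frac_mult_cong: "frac x = frac y \<Longrightarrow> frac (real a * x) = frac (real a * y)"
proof -
  assume "frac x = frac y"
  then have "x = y + of_int (\<lfloor>x\<rfloor> - \<lfloor>y\<rfloor>)" by (simp add: frac_def)
  then have "real a * x = real a * y + of_int (int a * (\<lfloor>x\<rfloor> - \<lfloor>y\<rfloor>))"
    by (metis (no_types) distrib_left of_int_mult of_int_of_nat_eq)
  then show ?thesis by (simp only: frac_def floor_add_int[symmetric])
qed

lemma walsh_frac:
  assumes "2 \<le> a" "frac x = frac y"
  shows "walsh a n x = walsh a n y"
  using assms
proof (induction n arbitrary: x y rule: walsh_induct)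
  case zero then show ?case by (simp add: walsh_0)
next
  case (step d n)
  show ?case
    using step.IH[OF frac_mult_cong[OF step.prems, of a]] step.hyps assms(1) rademacher0_frac[OF step.prems, of a]
    by (simp add: walsh_step)
qed

lemma norm_rademacher0: "cmod (rademacher0 a x) = 1"
  by (simp add: rademacher0_def norm_power)

lemma norm_walsh: "2 \<le> a \<Longrightarrow> cmod (walsh a n x) = 1"
  unfolding walsh_def rademacher_def by (simp add: prod_norm[symmetric] norm_power norm_rademacher0)

lemma rademacher0_measurable [measurable]: "rademacher0 a \<in> borel_measurable borel"
  unfolding rademacher0_def frac_def by measurable

lemma cell_measurable [measurable]: "cell a m \<in> measurable borel (count_space UNIV)"
  unfolding cell_def frac_def by measurable

lemma walsh_measurable [measurable]: "walsh a n \<in> borel_measurable borel"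
  unfolding walsh_def rademacher_def by measurable

text \<open>Base-\<open>a\<close> digits that occupy disjoint positions do not interact, so indices add when the functions are
multiplied.\<close>

lemma walsh_mult:
  assumes "2 \<le> a" "n < a ^ M"
  shows "walsh a (n + a ^ M * j) x = walsh a n x * walsh a j (real a ^ M * x)"
  using assms(2)
proof (induction M arbitrary: n x)
  case 0 then show ?case by (simp add: walsh_0)
next
  case (Suc M)
  obtain d k where n: "n = d + a * k" "d < a" by (rule nat_base_cases[OF assms(1)])
  have "a * k < a * a ^ M" using Suc.prems n(1) unfolding power_Suc by linarith
  then have k: "k < a ^ M" using assms(1) by simp
  have "n + a ^ Suc M * j = d + a * (k + a ^ M * j)" by (simp add: n algebra_simps)
  then have "walsh a (n + a ^ Suc M * j) x = rademacher0 a x ^ d * walsh a (k + a ^ M * j) (real a * x)"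
    using walsh_step[OF assms(1) n(2)] by metis
  moreover have "walsh a n x = rademacher0 a x ^ d * walsh a k (real a * x)"
    unfolding n(1) by (rule walsh_step[OF assms(1) n(2)])
  ultimately show ?case using Suc.IH[OF k, of "real a * x"] by (simp add: mult_ac)
qed

lemma cell_less: "2 \<le> a \<Longrightarrow> cell a m x < a ^ m"
proof -
  assume "2 \<le> a"
  then have "real a ^ m * frac x < real a ^ m" using frac_lt_1[of x] by simp
  then have "\<lfloor>real a ^ m * frac x\<rfloor> < int (a ^ m)" by (simp add: floor_less_iff)
  moreover have "0 \<le> \<lfloor>real a ^ m * frac x\<rfloor>" by simp
  ultimately show ?thesis unfolding cell_def by linarith
qed

lemma cell_eqI:
  assumes "real k \<le> real a ^ m * frac x" "real a ^ m * frac x < real k + 1"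
  shows "cell a m x = k"
proof -
  have "\<lfloor>real a ^ m * frac x\<rfloor> = int k" by (rule floor_unique) (use assms in auto)
  then show ?thesis by (simp add: cell_def)
qed

lemma cell_bounds:
  "real (cell a m x) \<le> real a ^ m * frac x" "real a ^ m * frac x < real (cell a m x) + 1"
proof -
  have "real (cell a m x) = of_int \<lfloor>real a ^ m * frac x\<rfloor>" by (simp add: cell_def)
  then show "real (cell a m x) \<le> real a ^ m * frac x" "real a ^ m * frac x < real (cell a m x) + 1"
    by linarith+
qed

text \<open>The digits of \<open>x\<close> after position \<open>m\<close> are the digits of \<open>a\<^sup>m x\<close>.\<close>

lemma cell_add:
  "cell a (m + k) x = cell a m x * a ^ k + cell a k (real a ^ m * x)"
proof (rule cell_eqI)
  let ?y = "real a ^ m * frac x"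
  have "frac (real a ^ m * x) = frac ?y"
    using frac_mult_cong[of x "frac x" "a ^ m"] by simp
  also have "\<dots> = ?y - real (cell a m x)" by (simp add: frac_def cell_def)
  finally have *: "frac (real a ^ m * x) = ?y - real (cell a m x)" .
  have "real a ^ (m + k) * frac x = real (cell a m x) * real a ^ k + real a ^ k * frac (real a ^ m * x)"
    unfolding * by (simp add: power_add algebra_simps)
  then show "real (cell a m x * a ^ k + cell a k (real a ^ m * x)) \<le> real a ^ (m + k) * frac x"
    "real a ^ (m + k) * frac x < real (cell a m x * a ^ k + cell a k (real a ^ m * x)) + 1"
    using cell_bounds[of a k "real a ^ m * x"] by simp_all
qed

lemma cell_grid: "2 \<le> a \<Longrightarrow> p < a ^ m \<Longrightarrow> cell a m (real p / real a ^ m) = p"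
proof (rule cell_eqI)
  assume *: "2 \<le> a" "p < a ^ m"
  then have "real p < real a ^ m" by (metis of_nat_less_iff of_nat_power)
  then have "frac (real p / real a ^ m) = real p / real a ^ m"
    using * by (simp add: frac_eq)
  then show "real p \<le> real a ^ m * frac (real p / real a ^ m)"
    "real a ^ m * frac (real p / real a ^ m) < real p + 1" using * by auto
qed

lemma root_of_unity_power_inject:
  assumes "2 \<le> a" "(exp (2 * of_real pi * \<i> / of_nat a) :: complex) ^ d = exp (2 * of_real pi * \<i> / of_nat a) ^ e" "d < a" "e < a"
  shows "d = e"
proof -
  have p: "(exp (2 * of_real pi * \<i> / of_nat a) :: complex) ^ j = exp (2 * of_real pi * \<i> * of_nat j / of_nat a)" for j
    by (simp add: exp_of_nat_mult[symmetric] mult_ac)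
  show ?thesis using assms complex_root_unity_eq[of a d e]
    by (simp add: p cong_def)
qed

lemma root_of_unity_power: "2 \<le> a \<Longrightarrow> (exp (2 * of_real pi * \<i> / of_nat a) :: complex) ^ a = 1"
  by (simp add: exp_of_nat_mult[symmetric])

text \<open>The Dirichlet kernel of order \<open>a\<^sup>m\<close> is concentrated on a single cell. By \<open>walsh_step\<close> the sum for \<open>m + 1\<close>
factors into the sum for \<open>m\<close> at \<open>a x\<close> and \<open>a y\<close> and a geometric sum over the powers of a root of unity, which vanishes
unless the first digits of \<open>x\<close> and \<open>y\<close> agree.\<close>

lemma walsh_kernel:
  assumes a: "2 \<le> a"
  shows "(\<Sum>n<a ^ m. cnj (walsh a n y) * walsh a n x) = (if cell a m x = cell a m y then of_nat (a ^ m) else 0)"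
proof (induction m arbitrary: x y)
  case 0
  then show ?case using cell_less[OF a, of 0 x] cell_less[OF a, of 0 y] by (simp add: walsh_0)
next
  case (Suc m)
  let ?z = "cnj (rademacher0 a y) * rademacher0 a x"
  have "(\<Sum>n<a ^ Suc m. cnj (walsh a n y) * walsh a n x)
      = (\<Sum>k<a ^ m. \<Sum>d<a. cnj (walsh a (d + a * k) y) * walsh a (d + a * k) x)"
    using sum.nat_group[of "\<lambda>n. cnj (walsh a n y) * walsh a n x" a "a ^ m", symmetric]
    by (simp add: mult_ac sum.atLeastLessThan_shift_0[of _ "_ * _"] lessThan_atLeast0 add.commute)
  also have "\<dots> = (\<Sum>k<a ^ m. (\<Sum>d<a. ?z ^ d) * (cnj (walsh a k (real a * y)) * walsh a k (real a * x)))"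
    unfolding sum_distrib_right
    by (intro sum.cong refl) (use a in \<open>simp add: walsh_step power_mult_distrib mult.assoc mult.left_commute\<close>)
  also have "\<dots> = (\<Sum>d<a. ?z ^ d) * (if cell a m (real a * x) = cell a m (real a * y) then of_nat (a ^ m) else 0)"
    by (simp add: sum_distrib_left[symmetric] Suc.IH)
  also have "(\<Sum>d<a. ?z ^ d) = (if cell a 1 x = cell a 1 y then of_nat a else 0)"
  proof -
    have r: "cnj (rademacher0 a y) = 1 / rademacher0 a y"
      using norm_rademacher0[of a y] by (metis complex_cnj_cnj divide_conv_cnj div_by_1 mult_1)
    have ra: "rademacher0 a x ^ a = 1" for x
      using root_of_unity_power[OF a] by (simp add: rademacher0_cell power_mult[symmetric] mult.commute) (simp add: power_mult)
    have "?z ^ a = 1" by (simp add: r power_divide power_mult_distrib ra)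
    moreover have "?z = 1 \<longleftrightarrow> cell a 1 x = cell a 1 y"
    proof -
      have "rademacher0 a y \<noteq> 0" using norm_rademacher0[of a y] by auto
      then have "?z = 1 \<longleftrightarrow> rademacher0 a x = rademacher0 a y" by (auto simp: r field_simps)
      also have "\<dots> \<longleftrightarrow> cell a 1 x = cell a 1 y"
        using root_of_unity_power_inject[OF a] cell_less[OF a, of 1] by (auto simp: rademacher0_cell)
      finally show ?thesis .
    qed
    ultimately show ?thesis by (auto simp: sum_gp_strict geometric_sum)
  qed
  also have "(if cell a 1 x = cell a 1 y then of_nat a else 0) * (if cell a m (real a * x) = cell a m (real a * y) then of_nat (a ^ m) else 0)
      = (if cell a (Suc m) x = cell a (Suc m) y then of_nat (a ^ Suc m) else (0::complex))"
  proof -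
    have "u * a ^ m + v = u' * a ^ m + v' \<longleftrightarrow> u = u' \<and> v = v'" if "v < a ^ m" "v' < a ^ m" for u v u' v'
    proof
      assume *: "u * a ^ m + v = u' * a ^ m + v'"
      have "u = (u * a ^ m + v) div a ^ m" "u' = (u' * a ^ m + v') div a ^ m"
        using that a by (simp_all add: div_add1_eq[of "_ * _"])
      then show "u = u' \<and> v = v'" using * by auto
    qed auto
    then show ?thesis using cell_add[of a 1 m x] cell_add[of a 1 m y] cell_less[OF a, of m] by simp
  qed
  finally show ?case .
qed

section \<open>Orthonormality\<close>

lemma mult_cnj_unit: "cmod z = 1 \<Longrightarrow> z * cnj z = 1"
  using complex_norm_square[of z] by simp

lemma borel_measurable_cnj [measurable (raw)]:
  "f \<in> borel_measurable M \<Longrightarrow> (\<lambda>x. cnj (f x)) \<in> borel_measurable M"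
  by (rule measurable_compose[OF _ borel_measurable_continuous_onI]) (auto intro: continuous_intros)

lemma frac_add_inverse:
  assumes a: "2 \<le> a"
  shows "frac (x + 1 / real a) = (if frac x + 1 / real a < 1 then frac x + 1 / real a else frac x + 1 / real a - 1)"
proof -
  have "frac (1 / real a) = 1 / real a" using a by (simp add: frac_eq)
  then show ?thesis using frac_add[of x "1 / real a"] by (simp only:)
qed

text \<open>Translation by \<open>1/a\<close> raises the first digit by one modulo \<open>a\<close>: a carry out of it changes \<open>x\<close> by 1, which is a
period.\<close>

lemma rademacher0_shift:
  assumes a: "2 \<le> a"
  shows "rademacher0 a (x + 1 / real a) = exp (2 * of_real pi * \<i> / of_nat a) * rademacher0 a x"
proof (cases "frac x + 1 / real a < 1")
  case True
  then have "frac (x + 1 / real a) = frac x + 1 / real a"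
    by (simp add: frac_add_inverse[OF a])
  then have "cell a 1 (x + 1 / real a) = Suc (cell a 1 x)"
    using cell_bounds[of a 1 x] a by (intro cell_eqI) (auto simp: algebra_simps)
  then show ?thesis by (simp add: rademacher0_cell)
next
  case False
  then have f: "frac (x + 1 / real a) = frac x + 1 / real a - 1"
    by (simp add: frac_add_inverse[OF a])
  then have *: "real a * frac (x + 1 / real a) = real a * frac x + 1 - real a"
    unfolding f using a by (simp add: field_simps)
  have 1: "cell a 1 x < a" using cell_less[OF a, of 1 x] by simp
  have 2: "real a * frac x < real a" using frac_lt_1[of x] a by simp
  have 4: "real a - 1 \<le> real a * frac x" using False a by (simp add: field_simps)
  then have 3: "cell a 1 x = a - 1" using 2 a by (intro cell_eqI) (auto simp: of_nat_diff)
  have "cell a 1 (x + 1 / real a) = 0"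
    using * 2 4 by (intro cell_eqI) auto
  then have "rademacher0 a (x + 1 / real a) = 1" by (simp add: rademacher0_cell)
  also have "\<dots> = exp (2 * of_real pi * \<i> / of_nat a) ^ Suc (a - 1)"
    using root_of_unity_power[OF a] a by simp
  finally show ?thesis unfolding rademacher0_cell[of a x] 3 by simp
qed

text \<open>Let \<open>j\<close> be the lowest position in which the digits of \<open>n\<close> and \<open>m\<close> differ, and translate by \<open>a\<^sup>-\<^sup>(\<^sup>j\<^sup>+\<^sup>1\<^sup>)\<close>. This
raises the \<open>j\<close>-th digit of the argument and leaves the later ones alone. The earlier ones may change
through carries, but there the two factors have equal exponents and cancel. So the product is
multiplied by a root of unity other than 1.\<close>

lemma walsh_translate:
  assumes a: "2 \<le> a" and "n \<noteq> m"
  obtains h \<zeta> where "0 \<le> h" "h < 1" "\<zeta> \<noteq> 1"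
    "\<And>x. walsh a n (x + h) * cnj (walsh a m (x + h)) = \<zeta> * (walsh a n x * cnj (walsh a m x))"
proof -
  have "\<exists>h \<zeta>. 0 \<le> h \<and> h < 1 \<and> \<zeta> \<noteq> 1 \<and>
    (\<forall>x. walsh a n (x + h) * cnj (walsh a m (x + h)) = \<zeta> * (walsh a n x * cnj (walsh a m x)))"
    using assms(2)
  proof (induction "n + m" arbitrary: n m rule: less_induct)
    case less
    obtain d k where n: "n = d + a * k" "d < a" by (rule nat_base_cases[OF a])
    obtain e l where m: "m = e + a * l" "e < a" by (rule nat_base_cases[OF a])
    let ?w = "exp (2 * of_real pi * \<i> / of_nat a) :: complex"
    have wn: "walsh a n x = rademacher0 a x ^ d * walsh a k (real a * x)" for x
      unfolding n(1) by (rule walsh_step[OF a n(2)])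
    have wm: "walsh a m x = rademacher0 a x ^ e * walsh a l (real a * x)" for x
      unfolding m(1) by (rule walsh_step[OF a m(2)])
    show ?case
    proof (cases "d = e")
      case False
      have per: "walsh a j (real a * (x + 1 / real a)) = walsh a j (real a * x)" for j x
        using a by (intro walsh_frac[OF a]) (simp add: distrib_left frac_add_1)
      have "?w ^ d * cnj (?w ^ e) \<noteq> 1"
      proof
        assume *: "?w ^ d * cnj (?w ^ e) = 1"
        have "cmod (?w ^ e) = 1" by (simp add: norm_power)
        then have "?w ^ e * cnj (?w ^ e) = 1" by (rule mult_cnj_unit)
        then have "?w ^ d * cnj (?w ^ e) = ?w ^ e * cnj (?w ^ e)" "cnj (?w ^ e) \<noteq> 0"
          using * by (simp_all only:) auto
        then have "?w ^ d = ?w ^ e" using mult_right_cancel by blast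
        then show False using root_of_unity_power_inject[OF a _ n(2) m(2)] False by blast
      qed
      moreover have "walsh a n (x + 1 / real a) * cnj (walsh a m (x + 1 / real a))
          = (?w ^ d * cnj (?w ^ e)) * (walsh a n x * cnj (walsh a m x))" for x
        unfolding wn wm per rademacher0_shift[OF a] by (simp add: power_mult_distrib mult_ac)
      ultimately show ?thesis using a
        by (intro exI[of _ "1 / real a"] exI[of _ "?w ^ d * cnj (?w ^ e)"]) auto
    next
      case True
      then have kl: "k \<noteq> l" using less.prems n m by auto
      then have "0 < k + l" by auto
      then have "k + l < a * (k + l)" using a by simp
      then have "k + l < n + m" unfolding n m by (simp add: distrib_left)
      then obtain h \<zeta> where h: "0 \<le> h" "h < 1" "\<zeta> \<noteq> 1"
        "\<And>x. walsh a k (x + h) * cnj (walsh a l (x + h)) = \<zeta> * (walsh a k x * cnj (walsh a l x))"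
        using less.hyps[of k l] kl by blast
      have u: "rademacher0 a x ^ e * cnj (rademacher0 a x ^ e) = 1" for x
        by (rule mult_cnj_unit) (simp add: norm_power norm_rademacher0)
      have f: "walsh a n x * cnj (walsh a m x) = walsh a k (real a * x) * cnj (walsh a l (real a * x))" for x
      proof -
        have "walsh a n x * cnj (walsh a m x) = (rademacher0 a x ^ e * cnj (rademacher0 a x ^ e)) * (walsh a k (real a * x) * cnj (walsh a l (real a * x)))"
          unfolding wn wm True by (simp add: mult_ac)
        then show ?thesis by (simp only: u mult_1)
      qed
      have "walsh a n (x + h / real a) * cnj (walsh a m (x + h / real a)) = \<zeta> * (walsh a n x * cnj (walsh a m x))" for x
        unfolding f using h(4)[of "real a * x"] a by (simp add: distrib_left)
      moreover have "h / real a < 1" using h a by (simp add: divide_less_eq)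
      ultimately show ?thesis using h a by (intro exI[of _ "h / real a"] exI[of _ \<zeta>]) auto
    qed
  qed
  then show ?thesis using that by blast
qed

lemma integral_period_shift:
  fixes f :: "real \<Rightarrow> complex"
  assumes [measurable]: "f \<in> borel_measurable borel" and b: "\<And>x. cmod (f x) \<le> B"
    and per: "\<And>x. f (x + 1) = f x" and h: "0 \<le> h" "h < 1"
  shows "(LINT x|lborel. indicator {0..<1::real} x *\<^sub>R f (x + h)) = (LINT x|lborel. indicator {0..<1::real} x *\<^sub>R f x)"
proof -
  have int: "integrable lborel (\<lambda>x. indicator {c..<d} x *\<^sub>R f x)" for c d :: real
  proof (rule integrableI_bounded_set_indicator[where B=B])
    show "emeasure lborel {c..<d} < \<infinity>"
      by (rule le_less_trans[OF emeasure_mono[of _ "{c..d}"]]) (auto simp: emeasure_lborel_Icc_eq)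
  qed (auto simp: b)
  have "(LINT x|lborel. indicator {h..<1+h} x *\<^sub>R f x) = (LINT x|lborel. indicator {h..<1+h} (h + x) *\<^sub>R f (h + x))"
    using lborel_integral_real_affine[of 1 "\<lambda>x. indicator {h..<1+h} x *\<^sub>R f x" h] by simp
  also have "\<dots> = (LINT x|lborel. indicator {0..<1::real} x *\<^sub>R f (x + h))"
    by (intro Bochner_Integration.integral_cong refl) (auto simp: indicator_def add.commute)
  finally have 1: "(LINT x|lborel. indicator {0..<1::real} x *\<^sub>R f (x + h)) = (LINT x|lborel. indicator {h..<1+h} x *\<^sub>R f x)" ..
  have "(LINT x|lborel. indicator {1..<1+h} x *\<^sub>R f x) = (LINT x|lborel. indicator {1..<1+h} (1 + x) *\<^sub>R f (1 + x))"
    using lborel_integral_real_affine[of 1 "\<lambda>x. indicator {1..<1+h} x *\<^sub>R f x" 1] by simp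
  also have "\<dots> = (LINT x|lborel. indicator {0..<h} x *\<^sub>R f x)"
    using per by (intro Bochner_Integration.integral_cong refl) (auto simp: indicator_def add.commute)
  finally have 2: "(LINT x|lborel. indicator {1..<1+h} x *\<^sub>R f x) = (LINT x|lborel. indicator {0..<h} x *\<^sub>R f x)" .
  have "(LINT x|lborel. indicator {h..<1+h} x *\<^sub>R f x) = (LINT x|lborel. indicator {h..<1} x *\<^sub>R f x + indicator {1..<1+h} x *\<^sub>R f x)"
    using h by (intro Bochner_Integration.integral_cong refl) (auto simp: indicator_def)
  also have "\<dots> = (LINT x|lborel. indicator {h..<1} x *\<^sub>R f x) + (LINT x|lborel. indicator {0..<h} x *\<^sub>R f x)"
    unfolding 2[symmetric] by (rule Bochner_Integration.integral_add[OF int int])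
  also have "\<dots> = (LINT x|lborel. indicator {h..<1} x *\<^sub>R f x + indicator {0..<h} x *\<^sub>R f x)"
    by (rule Bochner_Integration.integral_add[OF int int, symmetric])
  also have "\<dots> = (LINT x|lborel. indicator {0..<1::real} x *\<^sub>R f x)"
    using h by (intro Bochner_Integration.integral_cong refl) (auto simp: indicator_def)
  finally show ?thesis using 1 by simp
qed

lemma integral_closed_unit:
  fixes f :: "real \<Rightarrow> complex"
  assumes [measurable]: "f \<in> borel_measurable borel"
  shows "(LINT x|lborel. indicator {0..1::real} x *\<^sub>R f x) = (LINT x|lborel. indicator {0..<1::real} x *\<^sub>R f x)"
proof (rule integral_cong_AE)
  have "AE x in lborel. x \<noteq> (1::real)" by (rule AE_lborel_singleton)
  then show "AE x in lborel. indicator {0..1::real} x *\<^sub>R f x = indicator {0..<1::real} x *\<^sub>R f x"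
    by eventually_elim (auto simp: indicator_def)
qed auto

text \<open>By \<open>walsh_translate\<close> the integral over a period is invariant under a translation that multiplies it by
some \<open>\<zeta> \<noteq> 1\<close>, and so it is zero.\<close>

lemma walsh_orthonormal:
  assumes a: "2 \<le> a"
  shows "(LINT x|lborel. indicator {0..1::real} x *\<^sub>R (walsh a n x * cnj (walsh a m x))) = (if n = m then 1 else 0)"
proof (cases "n = m")
  case True
  have "walsh a n x * cnj (walsh a n x) = 1" for x
    by (intro mult_cnj_unit norm_walsh[OF a])
  then show ?thesis by (simp add: True)
next
  case False
  let ?g = "\<lambda>x. walsh a n x * cnj (walsh a m x)"
  let ?I = "LINT x|lborel. indicator {0..<1::real} x *\<^sub>R ?g x"
  obtain h \<zeta> where h: "0 \<le> h" "h < 1" "\<zeta> \<noteq> 1"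
    "\<And>x. ?g (x + h) = \<zeta> * ?g x" using walsh_translate[OF a False] by blast
  have "?I = (LINT x|lborel. indicator {0..<1::real} x *\<^sub>R ?g (x + h))"
    by (rule integral_period_shift[where B=1, symmetric])
      (use h walsh_frac[OF a frac_add_1] in \<open>auto simp: norm_mult norm_walsh[OF a]\<close>)
  also have "\<dots> = (LINT x|lborel. \<zeta> * (indicator {0..<1::real} x *\<^sub>R ?g x))"
    unfolding h(4) by simp
  also have "\<dots> = \<zeta> * ?I" by (rule Bochner_Integration.integral_mult_right_zero)
  finally have "?I = 0" using h(3) by simp
  moreover have "(LINT x|lborel. indicator {0..1::real} x *\<^sub>R ?g x) = ?I" by (rule integral_closed_unit) measurable
  ultimately show ?thesis using False by simp
qed

abbreviation LM :: "(real \<times> real) measure" where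
  "LM \<equiv> lebesgue_on unit_square"

lemma unit_square_cbox: "unit_square = cbox (0, 0) (1, 1)"
  by (simp add: unit_square_def cbox_Pair_eq)

lemma unit_square_sets [measurable, simp]: "unit_square \<in> sets borel" "unit_square \<in> sets lebesgue"
  by (simp_all add: unit_square_cbox)

lemma emeasure_LM: "emeasure LM (space LM) = 1"
proof -
  have "emeasure LM (space LM) = emeasure lborel unit_square"
    by (simp add: emeasure_restrict_space)
  also have "\<dots> = emeasure lborel ({0..1::real}) * emeasure lborel ({0..1::real})"
    unfolding unit_square_def lborel_prod[symmetric] by (rule lborel.emeasure_pair_measure_Times) auto
  finally show ?thesis by simp
qed

lemma finite_measure_LM: "finite_measure LM"
  by (rule finite_measureI) (simp only: emeasure_LM, simp)

lemma borel_LM: "f \<in> borel_measurable borel \<Longrightarrow> f \<in> borel_measurable LM"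
  by (intro measurable_restrict_space1 measurable_completion) simp

lemma integral_LM_prod:
  fixes f g :: "real \<Rightarrow> complex"
  assumes [measurable]: "f \<in> borel_measurable borel" "g \<in> borel_measurable borel"
    and b: "\<And>x. cmod (f x) \<le> B" "\<And>x. cmod (g x) \<le> C"
  shows "(LINT p|LM. f (fst p) * g (snd p)) =
    (LINT x|lborel. indicator {0..1::real} x *\<^sub>R f x) * (LINT x|lborel. indicator {0..1::real} x *\<^sub>R g x)"
proof -
  let ?F = "\<lambda>x. indicator {0..1::real} x *\<^sub>R f x" and ?G = "\<lambda>x. indicator {0..1::real} x *\<^sub>R g x"
  let ?h = "\<lambda>p. indicator unit_square p *\<^sub>R (f (fst p) * g (snd p))"
  have bm: "(\<lambda>p. f (fst p) * g (snd p)) \<in> borel_measurable borel"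
    unfolding borel_prod[symmetric] by measurable
  have h: "?h (x, y) = ?F x * ?G y" for x y by (auto simp: indicator_def unit_square_def)
  have "integrable lborel ?h"
    using bm emeasure_LM
    by (intro integrableI_bounded_set_indicator[where B="B * C"])
       (auto simp: norm_mult emeasure_restrict_space intro!: mult_mono b order_trans[OF norm_ge_zero b(1)])
  then have i: "integrable (lborel \<Otimes>\<^sub>M lborel) ?h" by (simp add: lborel_prod)
  have "(LINT p|LM. f (fst p) * g (snd p)) = (LINT p|lebesgue. ?h p)"
    by (subst integral_restrict_space) auto
  also have "\<dots> = (LINT p|lborel. ?h p)" using bm by (intro integral_completion) auto
  also have "\<dots> = (LINT x|lborel. LINT y|lborel. ?h (x, y))"
    using lborel_pair.integral_fst'[OF i] by (simp add: lborel_prod)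
  also have "\<dots> = (LINT x|lborel. ?F x) * (LINT y|lborel. ?G y)"
    unfolding h by (simp only: Bochner_Integration.integral_mult_right_zero Bochner_Integration.integral_mult_left_zero)
  finally show ?thesis .
qed

definition dwalsh :: "nat \<Rightarrow> nat \<times> nat \<Rightarrow> real \<times> real \<Rightarrow> complex" where
  "dwalsh a i p = walsh a (fst i) (fst p) * walsh a (snd i) (snd p)"

lemma dwalsh_measurable [measurable]: "dwalsh a i \<in> borel_measurable borel"
  unfolding dwalsh_def borel_prod[symmetric] by measurable

lemma norm_dwalsh: "2 \<le> a \<Longrightarrow> cmod (dwalsh a i p) = 1"
  by (simp add: dwalsh_def norm_mult norm_walsh)

lemma dwalsh_orthonormal:
  assumes a: "2 \<le> a"
  shows "(LINT p|LM. dwalsh a i p * cnj (dwalsh a j p)) = (if i = j then 1 else 0)"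
proof -
  have "(LINT p|LM. dwalsh a i p * cnj (dwalsh a j p)) =
    (LINT p|LM. (walsh a (fst i) (fst p) * cnj (walsh a (fst j) (fst p))) * (walsh a (snd i) (snd p) * cnj (walsh a (snd j) (snd p))))"
    by (intro Bochner_Integration.integral_cong refl) (simp add: dwalsh_def mult_ac)
  also have "\<dots> = (if fst i = fst j then 1 else 0) * (if snd i = snd j then 1 else 0)"
    by (subst integral_LM_prod[where B=1 and C=1]) (auto simp: norm_mult norm_walsh[OF a] walsh_orthonormal[OF a])
  finally show ?thesis by (simp add: prod_eq_iff)
qed

lemma integrable_LM_bounded:
  fixes f :: "real \<times> real \<Rightarrow> 'b :: {banach, second_countable_topology}"
  assumes "f \<in> borel_measurable LM" "\<And>p. p \<in> unit_square \<Longrightarrow> norm (f p) \<le> B"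
  shows "integrable LM f"
  using assms by (intro finite_measure.integrable_const_bound[OF finite_measure_LM, of _ B]) auto

lemma dwalsh_parseval:
  assumes a: "2 \<le> a" and S: "finite S"
  shows "(LINT p|LM. (cmod (\<Sum>i\<in>S. d i * dwalsh a i p))\<^sup>2) = (\<Sum>i\<in>S. (cmod (d i))\<^sup>2)"
proof -
  have int: "integrable LM (\<lambda>p. (d i * cnj (d j)) * (dwalsh a i p * cnj (dwalsh a j p)))" for i j
    by (rule integrable_LM_bounded[where B="cmod (d i * cnj (d j))"])
      (auto intro!: borel_LM simp: norm_mult norm_dwalsh[OF a])
  have "complex_of_real (LINT p|LM. (cmod (\<Sum>i\<in>S. d i * dwalsh a i p))\<^sup>2) =
     (LINT p|LM. (\<Sum>i\<in>S. \<Sum>j\<in>S. (d i * cnj (d j)) * (dwalsh a i p * cnj (dwalsh a j p))))"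
    unfolding integral_complex_of_real[symmetric]
    by (intro Bochner_Integration.integral_cong refl, subst complex_norm_square)
      (simp add: sum_product mult_ac)
  also have "\<dots> = (\<Sum>i\<in>S. \<Sum>j\<in>S. (d i * cnj (d j)) * (if i = j then 1 else 0))"
    using int by (simp add: Bochner_Integration.integral_sum dwalsh_orthonormal[OF a])
  also have "\<dots> = complex_of_real (\<Sum>i\<in>S. (cmod (d i))\<^sup>2)"
    unfolding of_real_sum complex_norm_square using S by (simp add: if_distrib sum.delta cong: if_cong)
  finally show ?thesis using of_real_eq_iff by blast
qed

text \<open>The square has measure 1, so that the \<open>L\<^sup>1\<close> norm is at most the \<open>L\<^sup>2\<close> norm, whatever subset of the terms is
summed. This is what makes the order of the terms within a spike irrelevant.\<close>

lemma dwalsh_L1_bound: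
  assumes a: "2 \<le> a" and S: "finite S" and t: "0 < t" "(\<Sum>i\<in>S. (cmod (d i))\<^sup>2) \<le> t\<^sup>2"
  shows "(LINT p|LM. cmod (\<Sum>i\<in>S. d i * dwalsh a i p)) \<le> t"
proof -
  let ?P = "\<lambda>p. \<Sum>i\<in>S. d i * dwalsh a i p"
  have m: "?P \<in> borel_measurable LM" by (rule borel_LM) measurable
  have b: "cmod (?P p) \<le> (\<Sum>i\<in>S. cmod (d i))" for p
    by (rule sum_norm_le) (simp add: norm_mult norm_dwalsh[OF a])
  have i1: "integrable LM (\<lambda>p. cmod (?P p))"
    using m b by (intro integrable_LM_bounded) auto
  have i2: "integrable LM (\<lambda>p. (cmod (?P p))\<^sup>2)"
    using m b by (intro integrable_LM_bounded[where B="(\<Sum>i\<in>S. cmod (d i))\<^sup>2"]) (auto intro: power_mono)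
  have i3: "integrable LM (\<lambda>p. t)" by (intro integrable_LM_bounded) auto
  have "(LINT p|LM. cmod (?P p)) \<le> (LINT p|LM. ((cmod (?P p))\<^sup>2 / t + t) / 2)"
  proof (rule integral_mono[OF i1])
    show "integrable LM (\<lambda>p. ((cmod (?P p))\<^sup>2 / t + t) / 2)" using i2 i3 by simp
    fix p
    \<comment> \<open>\<open>\<bar>P\<bar> \<le> (\<bar>P\<bar>\<^sup>2/t + t)/2\<close> replaces the Cauchy--Schwarz inequality\<close>
    have "0 \<le> (cmod (?P p) - t)\<^sup>2" by simp
    then show "cmod (?P p) \<le> ((cmod (?P p))\<^sup>2 / t + t) / 2"
      using t(1) by (simp add: field_simps power2_eq_square)
  qed
  also have "\<dots> = ((LINT p|LM. (cmod (?P p))\<^sup>2) / t + t) / 2"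
    using i2 i3 emeasure_LM by (simp add: measure_def)
  also have "\<dots> \<le> (t\<^sup>2 / t + t) / 2"
    unfolding dwalsh_parseval[OF a S] using t by (intro divide_right_mono add_right_mono) auto
  also have "\<dots> = t" using t by (simp add: power2_eq_square)
  finally show ?thesis .
qed

section \<open>Polynomials equal to the indicator of one cell off a small set\<close>

lemma walsh_integral:
  assumes a: "2 \<le> a"
  shows "(LINT x|lborel. indicator {0..1::real} x *\<^sub>R walsh a n x) = (if n = 0 then 1 else 0)"
  using walsh_orthonormal[OF a, of n 0] by (simp add: walsh_0)

lemma integrable_unit_bounded:
  fixes f :: "real \<Rightarrow> complex"
  assumes "f \<in> borel_measurable borel" "\<And>x. cmod (f x) \<le> B"
  shows "integrable lborel (\<lambda>x. indicator {0..1::real} x *\<^sub>R f x)"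
  by (rule integrableI_bounded_set_indicator[where B=B]) (use assms in auto)

text \<open>Only the constant function \<open>\<psi>\<^sub>0\<close> has a nonzero mean.\<close>

lemma walsh_sum_integral:
  assumes a: "2 \<le> a" and S: "finite S"
  shows "(LINT x|lborel. indicator {0..1::real} x *\<^sub>R (\<Sum>n\<in>S. e n * walsh a n x)) = (if 0 \<in> S then e 0 else 0)"
proof -
  have int: "integrable lborel (\<lambda>x. e n * (indicator {0..1::real} x *\<^sub>R walsh a n x))" for n
    by (intro Bochner_Integration.integrable_mult_right integrable_unit_bounded[where B=1])
      (auto simp: norm_walsh[OF a])
  have "(LINT x|lborel. indicator {0..1::real} x *\<^sub>R (\<Sum>n\<in>S. e n * walsh a n x))
      = (LINT x|lborel. (\<Sum>n\<in>S. e n * (indicator {0..1::real} x *\<^sub>R walsh a n x)))"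
    by (simp add: scaleR_sum_right)
  also have "\<dots> = (\<Sum>n\<in>S. e n * (if n = 0 then 1 else 0))"
    by (simp only: Bochner_Integration.integral_sum[OF int] Bochner_Integration.integral_mult_right_zero walsh_integral[OF a])
  also have "\<dots> = (if 0 \<in> S then e 0 else 0)"
    using S by (simp add: if_distrib cong: if_cong)
  finally show ?thesis .
qed

lemma walsh_at_0: "walsh a n 0 = 1"
  by (simp add: walsh_def rademacher_def rademacher0_def)

lemma cell_indicator:
  assumes a: "2 \<le> a" and p: "p < a ^ m"
  shows "indicator {x. cell a m x = p} x = (\<Sum>n<a ^ m. cnj (walsh a n (real p / real a ^ m)) / of_nat (a ^ m) * walsh a n x)"
proof -
  have "(\<Sum>n<a ^ m. cnj (walsh a n (real p / real a ^ m)) / of_nat (a ^ m) * walsh a n x)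
     = (\<Sum>n<a ^ m. cnj (walsh a n (real p / real a ^ m)) * walsh a n x) / of_nat (a ^ m)"
    by (simp add: sum_divide_distrib)
  also have "\<dots> = (if cell a m x = p then of_nat (a ^ m) else 0) / of_nat (a ^ m)"
    unfolding walsh_kernel[OF a] cell_grid[OF a p] ..
  also have "\<dots> = indicator {x. cell a m x = p} x" using a by simp
  finally show ?thesis ..
qed

lemma cell_integral:
  assumes a: "2 \<le> a" and p: "p < a ^ m"
  shows "(LINT x|lborel. indicator {0..1::real} x *\<^sub>R (indicator {x. cell a m x = p} x :: complex)) = 1 / of_nat (a ^ m)"
  unfolding cell_indicator[OF a p]
  using a by (subst walsh_sum_integral[OF a]) (auto simp: walsh_0)

lemma cell_0: "cell a m 0 = 0" by (simp add: cell_def)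

lemma walsh_kernel_minus_mean:
  assumes a: "2 \<le> a"
  shows "(\<Sum>j\<in>{1..<a ^ s}. walsh a j x) = of_nat (a ^ s) * indicator {x. cell a s x = 0} x - 1"
proof -
  have "(\<Sum>j<a ^ s. walsh a j x) = of_nat (a ^ s) * indicator {x. cell a s x = 0} x"
    using walsh_kernel[OF a, where m=s and y=0 and x=x] by (simp add: walsh_at_0 cell_0 indicator_def)
  moreover have "{..<a ^ s} = insert 0 {1..<a ^ s}" using a by auto
  ultimately show ?thesis by (simp add: walsh_0 algebra_simps)
qed

text \<open>The polynomial is \<open>1\<^sub>C(x) (1 - D(a\<^sup>M x))\<close> with \<open>C\<close> the cell and \<open>D\<close> the Dirichlet kernel of order \<open>a\<^sup>s\<close>, that is,
\<open>1\<^sub>C - a\<^sup>s 1\<^sub>B\<close>. As \<open>\<psi>\<^sub>0 = 1\<close>, the second factor has no term \<open>j = 0\<close>, so that no index below \<open>a\<^sup>M\<close> occurs. In particular the polynomial has mean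
zero, and this determines the measure of \<open>B\<close>.\<close>

lemma spike_polynomial_1:
  assumes a: "2 \<le> a" and p: "p < a ^ m" and N: "1 \<le> N"
  obtains S e B where "finite S" "S \<subseteq> {N..}" "card S \<le> a ^ (m + s)" "\<And>n. cmod (e n) \<le> 1 / real a ^ m"
    "B \<in> sets borel" "B \<subseteq> {x. cell a m x = p}"
    "(LINT x|lborel. indicator {0..1::real} x *\<^sub>R (indicator B x :: complex)) = 1 / of_nat (a ^ (m + s))"
    "\<And>x. x \<notin> B \<Longrightarrow> (\<Sum>n\<in>S. e n * walsh a n x) = indicator {x. cell a m x = p} x"
proof -
  \<comment> \<open>large enough for both \<open>N \<le> a\<^sup>M\<close> and for the digits of \<open>n < a\<^sup>m\<close> to lie below position \<open>M\<close>\<close>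
  define M where "M = N + m"
  have mM: "a ^ m \<le> a ^ M" unfolding M_def using a by (intro power_increasing) auto
  have "N < 2 ^ N" by (rule less_exp)
  also have "(2::nat) ^ N \<le> a ^ N" using a by (intro power_mono) auto
  also have "\<dots> \<le> a ^ M" unfolding M_def using a by (intro power_increasing) auto
  finally have NM: "N \<le> a ^ M" by simp
  define J where "J = {..<a ^ m} \<times> {1..<a ^ s}"
  define S where "S = (\<lambda>(n, j). n + a ^ M * j) ` J"
  define y where "y = real p / real a ^ m"
  define e where "e n = - (cnj (walsh a (n mod a ^ M) y) / of_nat (a ^ m))" for n
  let ?C = "{x. cell a m x = p}"
  define B where "B = {x. cell a m x = p \<and> cell a s (real a ^ M * x) = 0}"
  have inj: "inj_on (\<lambda>(n, j). n + a ^ M * j) J"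
  proof (rule inj_onI, clarsimp simp: J_def)
    fix n j n' j' assume *: "n < a ^ m" "n' < a ^ m" "n + a ^ M * j = n' + a ^ M * j'"
    have "n < a ^ M" "n' < a ^ M" using * mM by auto
    then have "n = (n + a ^ M * j) mod a ^ M" "n' = (n' + a ^ M * j') mod a ^ M" by auto
    then have "n = n'" using *(3) by simp
    then show "n = n' \<and> j = j'" using * a by simp
  qed
  have u: "(\<Sum>n\<in>S. e n * walsh a n x) = indicator ?C x - of_nat (a ^ s) * indicator B x" for x
  proof -
    have "(\<Sum>n\<in>S. e n * walsh a n x) = (\<Sum>(n, j)\<in>J. e (n + a ^ M * j) * walsh a (n + a ^ M * j) x)"
      unfolding S_def by (subst sum.reindex[OF inj]) (simp add: case_prod_beta)
    also have "\<dots> = (\<Sum>(n, j)\<in>J. (- (cnj (walsh a n y) / of_nat (a ^ m)) * walsh a n x) * walsh a j (real a ^ M * x))"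
    proof (rule sum.cong[OF refl], clarsimp simp: J_def)
      fix n j assume "n < a ^ m"
      then have "n < a ^ M" using mM by simp
      then show "e (n + a ^ M * j) * walsh a (n + a ^ M * j) x = - (cnj (walsh a n y) * walsh a n x * walsh a j (real a ^ M * x) / of_nat a ^ m)"
        by (simp add: e_def walsh_mult[OF a])
    qed
    also have "\<dots> = (\<Sum>n<a ^ m. - (cnj (walsh a n y) / of_nat (a ^ m)) * walsh a n x) * (\<Sum>j\<in>{1..<a ^ s}. walsh a j (real a ^ M * x))"
      unfolding J_def sum_product sum.cartesian_product ..
    also have "\<dots> = - indicator ?C x * (of_nat (a ^ s) * indicator {x. cell a s x = 0} (real a ^ M * x) - 1)"
      unfolding walsh_kernel_minus_mean[OF a] using cell_indicator[OF a p, of x] by (simp add: y_def sum_negf)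
    also have "\<dots> = indicator ?C x - of_nat (a ^ s) * indicator B x"
      by (auto simp: B_def indicator_def)
    finally show ?thesis .
  qed
  have fin: "finite S" unfolding S_def J_def by auto
  have SN: "S \<subseteq> {N..}"
  proof
    fix n assume "n \<in> S"
    then obtain k j where "n = k + a ^ M * j" "1 \<le> j" by (auto simp: S_def J_def)
    then have "a ^ M \<le> n" by (metis le_add2 mult.right_neutral mult_le_mono2 order_trans)
    then show "n \<in> {N..}" using NM by simp
  qed
  have cd: "card S \<le> a ^ (m + s)"
  proof -
    have "card S \<le> card J" unfolding S_def by (rule card_image_le) (simp add: J_def)
    also have "\<dots> \<le> a ^ (m + s)" by (simp add: J_def power_add)
    finally show ?thesis .
  qed
  have Bm [measurable]: "B \<in> sets borel"
    unfolding B_def by measurable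
  have BC: "B \<subseteq> ?C" by (auto simp: B_def)
  have Cm [measurable]: "?C \<in> sets borel" by measurable
  have int: "integrable lborel (\<lambda>x. indicator {0..1::real} x *\<^sub>R (indicator D x :: complex))" if "D \<in> sets borel" for D
    using that by (intro integrable_unit_bounded[where B=1]) (auto simp: indicator_def)
  \<comment> \<open>\<open>0 \<notin> S\<close>, so the mean of the polynomial vanishes; this yields the measure of \<open>B\<close>\<close>
  have "0 = (LINT x|lborel. indicator {0..1::real} x *\<^sub>R (\<Sum>n\<in>S. e n * walsh a n x))"
    using SN N by (subst walsh_sum_integral[OF a fin]) auto
  also have "\<dots> = (LINT x|lborel. indicator {0..1::real} x *\<^sub>R indicator ?C x - of_nat (a ^ s) * (indicator {0..1::real} x *\<^sub>R indicator B x))"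
    unfolding u by (intro Bochner_Integration.integral_cong refl) (auto simp: indicator_def)
  also have "\<dots> = 1 / of_nat (a ^ m) - of_nat (a ^ s) * (LINT x|lborel. indicator {0..1::real} x *\<^sub>R (indicator B x :: complex))"
    by (simp only: Bochner_Integration.integral_diff[OF int[OF Cm] Bochner_Integration.integrable_mult_right[OF int[OF Bm]]]
      Bochner_Integration.integral_mult_right_zero cell_integral[OF a p])
  finally have "(LINT x|lborel. indicator {0..1::real} x *\<^sub>R (indicator B x :: complex)) = 1 / of_nat (a ^ (m + s))"
    using a by (simp add: field_simps power_add)
  moreover have "cmod (e n) \<le> 1 / real a ^ m" for n
    by (simp add: e_def norm_divide norm_walsh[OF a] norm_power)
  moreover have "(\<Sum>n\<in>S. e n * walsh a n x) = indicator ?C x" if "x \<notin> B" for x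
    using that by (simp add: u)
  ultimately show ?thesis using that[of S e B] fin SN cd Bm BC by blast
qed

lemma measure_LM_Times:
  assumes [measurable]: "A \<in> sets borel" "B \<in> sets borel"
  shows "complex_of_real (measure LM ((A \<times> B) \<inter> unit_square)) =
    (LINT x|lborel. indicator {0..1::real} x *\<^sub>R indicator A x) * (LINT x|lborel. indicator {0..1::real} x *\<^sub>R indicator B x)"
proof -
  have "complex_of_real (measure LM ((A \<times> B) \<inter> unit_square)) = complex_of_real (LINT p|LM. indicator ((A \<times> B) \<inter> unit_square) p)"
    by (simp add: Int_commute)
  also have "\<dots> = (LINT p|LM. indicator A (fst p) * indicator B (snd p))"
    unfolding integral_complex_of_real[symmetric]
    by (intro Bochner_Integration.integral_cong refl) (auto simp: indicator_def)
  also have "\<dots> = (LINT x|lborel. indicator {0..1::real} x *\<^sub>R indicator A x) * (LINT x|lborel. indicator {0..1::real} x *\<^sub>R indicator B x)"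
    by (rule integral_LM_prod[where B=1 and C=1]) (auto simp: indicator_def)
  finally show ?thesis .
qed

definition cell2 :: "nat \<Rightarrow> nat \<Rightarrow> real \<times> real \<Rightarrow> nat \<times> nat" where
  "cell2 a m p = (cell a m (fst p), cell a m (snd p))"

lemma cell2_measurable [measurable]: "cell2 a m \<in> measurable borel (count_space UNIV)"
  unfolding cell2_def borel_prod[symmetric] by measurable

lemma borel_LM_sets: "B \<in> sets borel \<Longrightarrow> B \<inter> unit_square \<in> sets LM"
  by (simp add: sets_restrict_space_iff)

lemma measure_LM_Un:
  assumes "A \<in> sets borel" "B \<in> sets borel"
  shows "measure LM ((A \<union> B) \<inter> unit_square) \<le> measure LM (A \<inter> unit_square) + measure LM (B \<inter> unit_square)"
  unfolding Int_Un_distrib2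
  by (intro measure_Un_le borel_LM_sets assms)

text \<open>The product of two one-dimensional spike polynomials; it fails to be the indicator of the cell only on the union of two strips
inside that cell.\<close>

lemma spike_polynomial_2:
  assumes a: "2 \<le> a" and c: "c \<in> {..<a ^ m} \<times> {..<a ^ m}" and N: "1 \<le> N"
  obtains S e B where "finite S" "S \<subseteq> {N..} \<times> {N..}" "card S \<le> a ^ (2 * (m + s))" "\<And>i. cmod (e i) \<le> 1 / real a ^ (2 * m)"
    "B \<in> sets borel" "measure LM (B \<inter> unit_square) \<le> 2 / real a ^ (2 * m + s)"
    "\<And>p. p \<notin> B \<Longrightarrow> (\<Sum>i\<in>S. e i * dwalsh a i p) = (if cell2 a m p = c then 1 else 0)"
proof -
  obtain k l where c': "c = (k, l)" "k < a ^ m" "l < a ^ m" using c by auto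
  let ?C1 = "{x. cell a m x = k}" and ?C2 = "{x. cell a m x = l}"
  obtain S1 e1 B1 where 1: "finite S1" "S1 \<subseteq> {N..}" "card S1 \<le> a ^ (m + s)" "\<And>n. cmod (e1 n) \<le> 1 / real a ^ m"
    "B1 \<in> sets borel" "B1 \<subseteq> ?C1"
    "(LINT x|lborel. indicator {0..1::real} x *\<^sub>R (indicator B1 x :: complex)) = 1 / of_nat (a ^ (m + s))"
    "\<And>x. x \<notin> B1 \<Longrightarrow> (\<Sum>n\<in>S1. e1 n * walsh a n x) = indicator ?C1 x"
    using spike_polynomial_1[OF a c'(2) N] by blast
  obtain S2 e2 B2 where 2: "finite S2" "S2 \<subseteq> {N..}" "card S2 \<le> a ^ (m + s)" "\<And>n. cmod (e2 n) \<le> 1 / real a ^ m"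
    "B2 \<in> sets borel" "B2 \<subseteq> ?C2"
    "(LINT x|lborel. indicator {0..1::real} x *\<^sub>R (indicator B2 x :: complex)) = 1 / of_nat (a ^ (m + s))"
    "\<And>x. x \<notin> B2 \<Longrightarrow> (\<Sum>n\<in>S2. e2 n * walsh a n x) = indicator ?C2 x"
    using spike_polynomial_1[OF a c'(3) N] by blast
  have Cm: "?C1 \<in> sets borel" "?C2 \<in> sets borel" by measurable
  define e where "e i = e1 (fst i) * e2 (snd i)" for i
  define B where "B = (B1 \<times> ?C2) \<union> (?C1 \<times> B2)"
  have prod: "(\<Sum>i\<in>S1 \<times> S2. e i * dwalsh a i p) = (\<Sum>n\<in>S1. e1 n * walsh a n (fst p)) * (\<Sum>n\<in>S2. e2 n * walsh a n (snd p))" for p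
    unfolding sum_product sum.cartesian_product
    by (intro sum.cong refl) (auto simp: e_def dwalsh_def)
  have val: "(\<Sum>i\<in>S1 \<times> S2. e i * dwalsh a i p) = (if cell2 a m p = c then 1 else 0)" if "p \<notin> B" for p
  proof -
    obtain x y where xy: "p = (x, y)" by (cases p)
    show ?thesis
    proof (cases "x \<in> B1 \<or> y \<in> B2")
      case False
      then show ?thesis unfolding prod using 1(8)[of x] 2(8)[of y] by (auto simp: xy c' cell2_def indicator_def)
    next
      case True
      then have "x \<notin> ?C1 \<and> x \<notin> B1 \<or> y \<notin> ?C2 \<and> y \<notin> B2" using that 1(6) 2(6) by (auto simp: B_def xy)
      then have "(\<Sum>n\<in>S1. e1 n * walsh a n x) = 0 \<or> (\<Sum>n\<in>S2. e2 n * walsh a n y) = 0"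
        "cell2 a m p \<noteq> c"
        using 1(8)[of x] 2(8)[of y] by (auto simp: xy c' cell2_def)
      then show ?thesis unfolding prod by (auto simp: xy)
    qed
  qed
  have ms: "complex_of_real (measure LM ((B1 \<times> ?C2) \<inter> unit_square)) = of_real (1 / real a ^ (2 * m + s))"
    "complex_of_real (measure LM ((?C1 \<times> B2) \<inter> unit_square)) = of_real (1 / real a ^ (2 * m + s))"
    unfolding measure_LM_Times[OF 1(5) Cm(2)] measure_LM_Times[OF Cm(1) 2(5)] 1(7) 2(7) cell_integral[OF a c'(2)] cell_integral[OF a c'(3)]
    by (simp_all add: power_add mult_2)
  then have ms': "measure LM ((B1 \<times> ?C2) \<inter> unit_square) = 1 / real a ^ (2 * m + s)"
    "measure LM ((?C1 \<times> B2) \<inter> unit_square) = 1 / real a ^ (2 * m + s)"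
    unfolding of_real_eq_iff by auto
  have Bs: "B1 \<times> ?C2 \<in> sets borel" "?C1 \<times> B2 \<in> sets borel"
    unfolding borel_prod[symmetric] using 1(5) 2(5) Cm by auto
  have "measure LM (B \<inter> unit_square) \<le> measure LM ((B1 \<times> ?C2) \<inter> unit_square) + measure LM ((?C1 \<times> B2) \<inter> unit_square)"
    unfolding B_def by (rule measure_LM_Un[OF Bs])
  then have mB: "measure LM (B \<inter> unit_square) \<le> 2 / real a ^ (2 * m + s)" unfolding ms' by simp
  have "card (S1 \<times> S2) \<le> a ^ (m + s) * a ^ (m + s)"
    unfolding card_cartesian_product using 1(3) 2(3) by (rule mult_le_mono)
  then have cd: "card (S1 \<times> S2) \<le> a ^ (2 * (m + s))" by (simp only: mult_2 power_add[of a "m + s" "m + s"])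
  have "cmod (e i) \<le> 1 / real a ^ m * (1 / real a ^ m)" for i
    unfolding e_def norm_mult using 1(4) 2(4) by (intro mult_mono) auto
  then have ce: "cmod (e i) \<le> 1 / real a ^ (2 * m)" for i by (simp add: power_add mult_2)
  have "S1 \<times> S2 \<subseteq> {N..} \<times> {N..}" "finite (S1 \<times> S2)" "B \<in> sets borel"
    using 1(1,2) 2(1,2) Bs by (auto simp: B_def)
  then show ?thesis using that[of "S1 \<times> S2" e B] cd ce mB val by blast
qed

section \<open>Polynomials representing step functions, with controlled partial sums\<close>

text \<open>A polynomial is kept as a list of indices with coefficients, because the order of its terms is needed for
partial sums.\<close>

definition wpoly :: "nat \<Rightarrow> ((nat \<times> nat) \<times> complex) list \<Rightarrow> real \<times> real \<Rightarrow> complex" where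
  "wpoly a ls p = (\<Sum>(i, z)\<leftarrow>ls. z * dwalsh a i p)"

lemma wpoly_append: "wpoly a (ls @ ls') p = wpoly a ls p + wpoly a ls' p"
  by (simp add: wpoly_def)

lemma wpoly_map:
  assumes "distinct xs"
  shows "wpoly a (map (\<lambda>i. (i, e i)) xs) p = (\<Sum>i\<in>set xs. e i * dwalsh a i p)"
  using assms by (simp add: wpoly_def comp_def sum_list_distinct_conv_sum_set)

lemma norm_wpoly:
  assumes "2 \<le> a" shows "cmod (wpoly a ls p) \<le> (\<Sum>(i, z)\<leftarrow>ls. cmod z)"
proof (induction ls)
  case (Cons x ls)
  have "cmod (wpoly a (x # ls) p) \<le> cmod (snd x * dwalsh a (fst x) p) + cmod (wpoly a ls p)"
    by (simp add: wpoly_def case_prod_beta norm_triangle_ineq)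
  then show ?case using Cons by (simp add: norm_mult norm_dwalsh[OF assms] case_prod_beta)
qed (simp add: wpoly_def)

lemma wpoly_measurable [measurable]: "wpoly a ls \<in> borel_measurable borel"
  unfolding wpoly_def by (induction ls) (simp_all add: case_prod_beta)

lemma spike_list:
  assumes a: "2 \<le> a" and c: "c \<in> {..<a ^ m} \<times> {..<a ^ m}" and N: "1 \<le> N"
    and g: "cmod g \<le> G" and G: "0 < G"
  obtains ls B where "distinct (map fst ls)" "fst ` set ls \<subseteq> {N..} \<times> {N..}" "length ls \<le> a ^ (2 * (m + s))"
    "\<And>i z. (i, z) \<in> set ls \<Longrightarrow> cmod z \<le> G / real a ^ (2 * m)"
    "B \<in> sets borel" "measure LM (B \<inter> unit_square) \<le> 2 / real a ^ (2 * m + s)"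
    "\<And>p. p \<notin> B \<Longrightarrow> wpoly a ls p = (if cell2 a m p = c then g else 0)"
    "\<And>n. (LINT p|LM. cmod (wpoly a (take n ls) p)) \<le> G * real a ^ s / real a ^ m"
proof -
  obtain S e B where S: "finite S" "S \<subseteq> {N..} \<times> {N..}" "card S \<le> a ^ (2 * (m + s))" "\<And>i. cmod (e i) \<le> 1 / real a ^ (2 * m)"
    "B \<in> sets borel" "measure LM (B \<inter> unit_square) \<le> 2 / real a ^ (2 * m + s)"
    "\<And>p. p \<notin> B \<Longrightarrow> (\<Sum>i\<in>S. e i * dwalsh a i p) = (if cell2 a m p = c then 1 else 0)"
    using spike_polynomial_2[OF a c N] by blast
  obtain xs where xs: "distinct xs" "set xs = S" using finite_distinct_list[OF S(1)] by blast
  define ls where "ls = map (\<lambda>i. (i, g * e i)) xs"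
  have ce: "cmod (g * e i) \<le> G / real a ^ (2 * m)" for i
    using mult_mono[OF g S(4)[of i]] G by (simp add: norm_mult)
  have L: "(LINT p|LM. cmod (wpoly a (take n ls) p)) \<le> G * real a ^ s / real a ^ m" for n
  proof -
    let ?A = "set (take n xs)"
    have A: "?A \<subseteq> S" using xs(2) set_take_subset by fast
    have "wpoly a (take n ls) p = (\<Sum>i\<in>?A. (g * e i) * dwalsh a i p)" for p
      unfolding ls_def take_map using xs(1) by (intro wpoly_map distinct_take)
    moreover have "(LINT p|LM. cmod (\<Sum>i\<in>?A. (g * e i) * dwalsh a i p)) \<le> G * real a ^ s / real a ^ m"
    proof (rule dwalsh_L1_bound[OF a])
      show "0 < G * real a ^ s / real a ^ m" using G a by simp
      have "(\<Sum>i\<in>?A. (cmod (g * e i))\<^sup>2) \<le> (\<Sum>i\<in>?A. (G / real a ^ (2 * m))\<^sup>2)"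
        using ce by (intro sum_mono power_mono) auto
      also have "\<dots> = real (card ?A) * (G / real a ^ (2 * m))\<^sup>2" by simp
      also have "\<dots> \<le> real (a ^ (2 * (m + s))) * (G / real a ^ (2 * m))\<^sup>2"
        using order_trans[OF card_mono[OF S(1) A] S(3)] unfolding of_nat_le_iff[symmetric, where 'a=real]
        by (rule mult_right_mono) simp
      also have "\<dots> = (G * real a ^ s / real a ^ m)\<^sup>2"
      proof -
        have "real (a ^ (2 * (m + s))) = (real a ^ m * real a ^ s)\<^sup>2" "real a ^ (2 * m) = (real a ^ m)\<^sup>2"
          by (simp_all add: power_mult_distrib power_add mult_2 power2_eq_square)
        then show ?thesis using a by (simp add: power_divide power_mult_distrib field_simps power2_eq_square)
      qed
      finally show "(\<Sum>i\<in>?A. (cmod (g * e i))\<^sup>2) \<le> (G * real a ^ s / real a ^ m)\<^sup>2" .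
    qed simp
    ultimately show ?thesis by simp
  qed
  have "distinct (map fst ls)" "fst ` set ls \<subseteq> {N..} \<times> {N..}" "length ls \<le> a ^ (2 * (m + s))"
    using xs S(2,3) distinct_card[OF xs(1)] by (auto simp: ls_def comp_def)
  moreover have "cmod z \<le> G / real a ^ (2 * m)" if "(i, z) \<in> set ls" for i z
    using that ce by (auto simp: ls_def)
  moreover have "wpoly a ls p = (if cell2 a m p = c then g else 0)" if "p \<notin> B" for p
  proof -
    have "wpoly a ls p = (\<Sum>i\<in>S. (g * e i) * dwalsh a i p)"
      unfolding ls_def wpoly_map[OF xs(1)] xs(2) ..
    also have "\<dots> = g * (\<Sum>i\<in>S. e i * dwalsh a i p)" by (simp add: sum_distrib_left mult_ac)
    finally show ?thesis using S(7)[OF that] by simp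
  qed
  ultimately show ?thesis using that[of ls B] S(5,6) L by blast
qed

lemma integrable_wpoly: "2 \<le> a \<Longrightarrow> integrable LM (wpoly a ls)"
  by (rule integrable_LM_bounded[OF borel_LM norm_wpoly]) measurable

text \<open>The cells are treated one after the other, each with frequencies beyond those already used. The error
\<open>R\<close> of a partial sum is the part of the single spike that is cut off, so its bound does not grow with the
number of cells.\<close>

lemma step_block_cells:
  assumes a: "2 \<le> a" and N: "1 \<le> N" and G: "0 < G"
    and cs: "distinct cs" "set cs \<subseteq> {..<a ^ m} \<times> {..<a ^ m}" and g: "\<forall>c\<in>set cs. cmod (g c) \<le> G"
  shows "\<exists>ls B. distinct (map fst ls) \<and> fst ` set ls \<subseteq> {N..} \<times> {N..} \<and> length ls \<le> length cs * a ^ (2 * (m + s)) \<and>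
    (\<forall>(i, z)\<in>set ls. cmod z \<le> G / real a ^ (2 * m)) \<and>
    B \<in> sets borel \<and> measure LM (B \<inter> unit_square) \<le> length cs * (2 / real a ^ (2 * m + s)) \<and>
    (\<forall>p. p \<notin> B \<longrightarrow> wpoly a ls p = (if cell2 a m p \<in> set cs then g (cell2 a m p) else 0)) \<and>
    (\<forall>n. \<exists>R. integrable LM R \<and> (LINT p|LM. cmod (R p)) \<le> G * real a ^ s / real a ^ m \<and>
      (\<forall>p. p \<notin> B \<longrightarrow> cmod (wpoly a (take n ls) p) \<le> cmod (if cell2 a m p \<in> set cs then g (cell2 a m p) else 0) + cmod (R p)))"
  using cs g
proof (induction cs rule: rev_induct)
  case Nil
  show ?case
    using G by (intro exI[of _ "[]"] exI[of _ "{}"]) (auto simp: wpoly_def intro!: exI[of _ "\<lambda>p. 0 :: complex"])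
next
  case (snoc c cs)
  let ?F = "\<lambda>cs p. if cell2 a m p \<in> set cs then g (cell2 a m p) else 0"
  have "distinct cs" "set cs \<subseteq> {..<a ^ m} \<times> {..<a ^ m}" "\<forall>c\<in>set cs. cmod (g c) \<le> G"
    using snoc.prems by auto
  from snoc.IH[OF this] obtain ls B where L: "distinct (map fst ls)" "fst ` set ls \<subseteq> {N..} \<times> {N..}"
    "length ls \<le> length cs * a ^ (2 * (m + s))"
    "\<forall>(i, z)\<in>set ls. cmod z \<le> G / real a ^ (2 * m)"
    "B \<in> sets borel" "measure LM (B \<inter> unit_square) \<le> length cs * (2 / real a ^ (2 * m + s))"
    "\<forall>p. p \<notin> B \<longrightarrow> wpoly a ls p = ?F cs p"
    "\<forall>n. \<exists>R. integrable LM R \<and> (LINT p|LM. cmod (R p)) \<le> G * real a ^ s / real a ^ m \<and>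
      (\<forall>p. p \<notin> B \<longrightarrow> cmod (wpoly a (take n ls) p) \<le> cmod (?F cs p) + cmod (R p))"
    by - (elim exE conjE, rule that, assumption+)
  note 1 = L(1-3) bspec[OF L(4)] L(5,6) L(7)[rule_format] L(8)[rule_format]
  \<comment> \<open>beyond all first coordinates used so far\<close>
  define N' where "N' = N + Suc (\<Sum>i\<in>fst ` set ls. fst i)"
  have N': "1 \<le> N'" "N \<le> N'" by (auto simp: N'_def)
  have less: "fst i < N'" if "i \<in> fst ` set ls" for i
    using member_le_sum[OF that, of fst] by (simp add: N'_def)
  have c: "c \<in> {..<a ^ m} \<times> {..<a ^ m}" "cmod (g c) \<le> G" "c \<notin> set cs" using snoc.prems by auto
  obtain ls' B' where 2: "distinct (map fst ls')" "fst ` set ls' \<subseteq> {N'..} \<times> {N'..}" "length ls' \<le> a ^ (2 * (m + s))"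
    "\<And>i z. (i, z) \<in> set ls' \<Longrightarrow> cmod z \<le> G / real a ^ (2 * m)"
    "B' \<in> sets borel" "measure LM (B' \<inter> unit_square) \<le> 2 / real a ^ (2 * m + s)"
    "\<And>p. p \<notin> B' \<Longrightarrow> wpoly a ls' p = (if cell2 a m p = c then g c else 0)"
    "\<And>n. (LINT p|LM. cmod (wpoly a (take n ls') p)) \<le> G * real a ^ s / real a ^ m"
    using spike_list[OF a c(1) N'(1) c(2) G] by blast
  have "i \<notin> fst ` set ls'" if "i \<in> fst ` set ls" for i
    using less[OF that] subsetD[OF 2(2), of i] by (auto simp: mem_Times_iff)
  then have d: "distinct (map fst (ls @ ls'))" using 1(1) 2(1) by auto
  have sub: "fst ` set (ls @ ls') \<subseteq> {N..} \<times> {N..}"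
  proof -
    have "{N'..} \<times> {N'..} \<subseteq> {N..} \<times> {N..}" using N'(2) by auto
    then have "fst ` set ls' \<subseteq> {N..} \<times> {N..}" using 2(2) by (rule order_trans[rotated])
    then show ?thesis using 1(2) by (simp add: image_Un)
  qed
  have len: "length (ls @ ls') \<le> length (cs @ [c]) * a ^ (2 * (m + s))" using 1(3) 2(3) by simp
  have mes: "measure LM ((B \<union> B') \<inter> unit_square) \<le> length (cs @ [c]) * (2 / real a ^ (2 * m + s))"
  proof -
    have "measure LM ((B \<union> B') \<inter> unit_square) \<le> measure LM (B \<inter> unit_square) + measure LM (B' \<inter> unit_square)"
      by (rule measure_LM_Un[OF 1(5) 2(5)])
    then show ?thesis using 1(6) 2(6) by (simp add: distrib_right add_divide_distrib)
  qed
  have val: "wpoly a (ls @ ls') p = ?F (cs @ [c]) p" if "p \<notin> B \<union> B'" for p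
    using 1(7)[of p] 2(7)[of p] that c(3) by (auto simp: wpoly_append)
  have pre: "\<exists>R. integrable LM R \<and> (LINT p|LM. cmod (R p)) \<le> G * real a ^ s / real a ^ m \<and>
      (\<forall>p. p \<notin> B \<union> B' \<longrightarrow> cmod (wpoly a (take n (ls @ ls')) p) \<le> cmod (?F (cs @ [c]) p) + cmod (R p))" for n
  proof (cases "n \<le> length ls")
    case True
    obtain R where R: "integrable LM R" "(LINT p|LM. cmod (R p)) \<le> G * real a ^ s / real a ^ m"
      "\<And>p. p \<notin> B \<Longrightarrow> cmod (wpoly a (take n ls) p) \<le> cmod (?F cs p) + cmod (R p)"
      using 1(8)[of n] by blast
    have "cmod (wpoly a (take n (ls @ ls')) p) \<le> cmod (?F (cs @ [c]) p) + cmod (R p)" if "p \<notin> B \<union> B'" for p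
    proof -
      have "cmod (?F cs p) \<le> cmod (?F (cs @ [c]) p)" by auto
      then show ?thesis using R(3)[of p] that True by simp
    qed
    then show ?thesis using R(1,2) by blast
  next
    case False
    have "cmod (wpoly a (take n (ls @ ls')) p) \<le> cmod (?F (cs @ [c]) p) + cmod (wpoly a (take (n - length ls) ls') p)" if "p \<notin> B \<union> B'" for p
    proof -
      have "cmod (?F cs p) \<le> cmod (?F (cs @ [c]) p)" by auto
      moreover have eq: "wpoly a (take n (ls @ ls')) p = ?F cs p + wpoly a (take (n - length ls) ls') p"
        using False 1(7)[of p] that by (simp add: wpoly_append)
      ultimately show ?thesis unfolding eq by (intro order_trans[OF norm_triangle_ineq] add_right_mono)
    qed
    then show ?thesis using 2(8)[of "n - length ls"] integrable_wpoly[OF a] by blast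
  qed
  have "\<forall>(i, z)\<in>set (ls @ ls'). cmod z \<le> G / real a ^ (2 * m)" using 1(4) 2(4) by fastforce
  moreover have "B \<union> B' \<in> sets borel" using 1(5) 2(5) by auto
  ultimately show ?case using d sub len mes val pre by blast
qed

lemma cell2_refine:
  assumes a: "2 \<le> a"
  shows "cell2 a m p = (fst (cell2 a (m + k) p) div a ^ k, snd (cell2 a (m + k) p) div a ^ k)"
proof -
  have "cell a (m + k) x div a ^ k = cell a m x" for x
    using a cell_less[OF a, of k "real a ^ m * x"] by (simp add: cell_add)
  then show ?thesis by (simp add: cell2_def)
qed

text \<open>First \<open>s\<close> is chosen to make the exceptional set small; then the step function is regarded as one on a much
finer subdivision. As the mesh \<open>a\<^sup>-\<^sup>n\<close> tends to zero, the sum of the squares of the coefficients remains bounded by \<open>a\<^sup>2\<^sup>s G\<^sup>2\<close>, and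
both their maximum and the \<open>L\<^sup>2\<close> norm of a single spike tend to zero.\<close>

lemma step_block:
  fixes g :: "nat \<times> nat \<Rightarrow> complex"
  assumes a: "2 \<le> a" and N: "1 \<le> N" and \<delta>: "0 < \<delta>"
  obtains ls B where "distinct (map fst ls)" "fst ` set ls \<subseteq> {N..} \<times> {N..}"
    "(\<Sum>(i, z)\<leftarrow>ls. cmod z powr (2 + \<delta>)) \<le> \<delta>"
    "B \<in> sets borel" "measure LM (B \<inter> unit_square) \<le> \<delta>"
    "\<And>p. p \<notin> B \<Longrightarrow> wpoly a ls p = g (cell2 a m p)"
    "\<And>n. \<exists>R. integrable LM R \<and> (LINT p|LM. cmod (R p)) \<le> \<delta> \<and>
      (\<forall>p. p \<notin> B \<longrightarrow> cmod (wpoly a (take n ls) p) \<le> cmod (g (cell2 a m p)) + cmod (R p))"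
proof -
  have "1 < a" using a by linarith
  then have a1: "1 < real a" by simp
  \<comment> \<open>the summand 1 only ensures \<open>0 < G\<close>\<close>
  define G where "G = 1 + (\<Sum>c\<in>{..<a ^ m} \<times> {..<a ^ m}. cmod (g c))"
  have G: "0 < G" unfolding G_def by (intro add_pos_nonneg sum_nonneg) auto
  have gG: "cmod (g c) \<le> G" if "c \<in> {..<a ^ m} \<times> {..<a ^ m}" for c
    using member_le_sum[OF that, of "\<lambda>c. cmod (g c)"] by (simp add: G_def)
  have lim0: "(\<lambda>k. C / real a ^ k) \<longlonglongrightarrow> 0" for C
    by (rule tendsto_divide_0[OF tendsto_const filterlim_realpow_sequentially_gt1]) (use a1 in auto)
  have "\<forall>\<^sub>F s in sequentially. 2 / real a ^ s < \<delta>"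
    using order_tendstoD(2)[OF lim0 \<delta>] .
  then obtain s where s: "2 / real a ^ s < \<delta>" by (auto dest: eventually_happens)
  define C where "C = real a ^ (2 * s) * G\<^sup>2"
  have ev1: "\<forall>\<^sub>F k in sequentially. (G * real a ^ s) / real a ^ k < \<delta>"
    using order_tendstoD(2)[OF lim0 \<delta>] .
  have "(\<lambda>k. C * (G / real a ^ k) powr \<delta>) \<longlonglongrightarrow> C * 0"
    by (intro tendsto_mult tendsto_const tendsto_zero_powrI[OF lim0 tendsto_const]) (use G \<delta> in auto)
  then have ev2: "\<forall>\<^sub>F k in sequentially. C * (G / real a ^ k) powr \<delta> < \<delta>"
    using order_tendstoD(2)[OF _ \<delta>] by simp
  obtain n where n: "m \<le> n" "(G * real a ^ s) / real a ^ n < \<delta>" "C * (G / real a ^ n) powr \<delta> < \<delta>"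
    using eventually_happens[OF eventually_conj[OF eventually_ge_at_top[of m] eventually_conj[OF ev1 ev2]]] by auto
  obtain k where k: "n = m + k" using n(1) le_Suc_ex by blast
  define h where "h c = g (fst c div a ^ k, snd c div a ^ k)" for c
  have hc: "h (cell2 a n p) = g (cell2 a m p)" for p
    unfolding h_def k cell2_refine[OF a, of m p k] by simp
  define cs where "cs = List.product [0..<a ^ n] [0..<a ^ n]"
  have cs: "distinct cs" "set cs \<subseteq> {..<a ^ n} \<times> {..<a ^ n}" "length cs = a ^ (2 * n)"
    by (auto simp: cs_def distinct_product power_add mult_2)
  have cin: "cell2 a n p \<in> set cs" for p
    using cell_less[OF a, of n] by (simp add: cs_def cell2_def)
  have hG: "\<forall>c\<in>set cs. cmod (h c) \<le> G"
  proof
    fix c assume "c \<in> set cs"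
    then have "fst c < a ^ m * a ^ k" "snd c < a ^ m * a ^ k" using cs(2) by (auto simp: k power_add)
    then show "cmod (h c) \<le> G" unfolding h_def by (intro gG) (auto simp: less_mult_imp_div_less)
  qed
  from step_block_cells[where m=n and s=s, OF a N G cs(1,2) hG]
  obtain ls B where L: "distinct (map fst ls)" "fst ` set ls \<subseteq> {N..} \<times> {N..}"
    "length ls \<le> length cs * a ^ (2 * (n + s))"
    "\<forall>(i, z)\<in>set ls. cmod z \<le> G / real a ^ (2 * n)"
    "B \<in> sets borel" "measure LM (B \<inter> unit_square) \<le> length cs * (2 / real a ^ (2 * n + s))"
    "\<forall>p. p \<notin> B \<longrightarrow> wpoly a ls p = (if cell2 a n p \<in> set cs then h (cell2 a n p) else 0)"
    "\<forall>j. \<exists>R. integrable LM R \<and> (LINT p|LM. cmod (R p)) \<le> G * real a ^ s / real a ^ n \<and>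
      (\<forall>p. p \<notin> B \<longrightarrow> cmod (wpoly a (take j ls) p) \<le> cmod (if cell2 a n p \<in> set cs then h (cell2 a n p) else 0) + cmod (R p))"
    by - (elim exE conjE, rule that, assumption+)
  have "(\<Sum>(i, z)\<leftarrow>ls. cmod z powr (2 + \<delta>)) \<le> (\<Sum>l\<leftarrow>ls. (G / real a ^ (2 * n)) powr (2 + \<delta>))"
    using L(4) \<delta> by (intro sum_list_mono) (fastforce intro!: powr_mono2)
  also have "\<dots> = real (length ls) * (G / real a ^ (2 * n)) powr (2 + \<delta>)"
    by (simp add: sum_list_triv)
  also have "\<dots> \<le> real (length cs * a ^ (2 * (n + s))) * (G / real a ^ (2 * n)) powr (2 + \<delta>)"
    using L(3) by (intro mult_right_mono) (simp_all only: of_nat_le_iff powr_ge_zero)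
  also have "(G / real a ^ (2 * n)) powr (2 + \<delta>) = (G / real a ^ (2 * n))\<^sup>2 * (G / real a ^ (2 * n)) powr \<delta>"
    using G a by (simp add: powr_add)
  also have "real (length cs * a ^ (2 * (n + s))) * ((G / real a ^ (2 * n))\<^sup>2 * (G / real a ^ (2 * n)) powr \<delta>) = C * (G / real a ^ (2 * n)) powr \<delta>"
    using a by (simp add: C_def cs(3) power2_eq_square power_add mult_2 field_simps)
  also have "\<dots> \<le> C * (G / real a ^ n) powr \<delta>"
  proof -
    have "real a ^ n \<le> real a ^ (2 * n)" using a by (intro power_increasing) auto
    then have "G / real a ^ (2 * n) \<le> G / real a ^ n" using G a by (intro divide_left_mono) auto
    then show ?thesis using G \<delta> by (intro mult_left_mono powr_mono2) (auto simp: C_def)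
  qed
  also have "\<dots> \<le> \<delta>" using n(3) by simp
  finally have S: "(\<Sum>(i, z)\<leftarrow>ls. cmod z powr (2 + \<delta>)) \<le> \<delta>" .
  have "length cs * (2 / real a ^ (2 * n + s)) = 2 / real a ^ s"
    using a by (simp add: cs(3) power_add)
  then have mB: "measure LM (B \<inter> unit_square) \<le> \<delta>" using L(6) s by linarith
  have "\<exists>R. integrable LM R \<and> (LINT p|LM. cmod (R p)) \<le> \<delta> \<and>
      (\<forall>p. p \<notin> B \<longrightarrow> cmod (wpoly a (take j ls) p) \<le> cmod (g (cell2 a m p)) + cmod (R p))" for j
  proof -
    obtain R where "integrable LM R" "(LINT p|LM. cmod (R p)) \<le> G * real a ^ s / real a ^ n"
      "\<And>p. p \<notin> B \<Longrightarrow> cmod (wpoly a (take j ls) p) \<le> cmod (if cell2 a n p \<in> set cs then h (cell2 a n p) else 0) + cmod (R p)"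
      using L(8) by blast
    then show ?thesis using cin n(2) by (intro exI[of _ R]) (auto simp: hc)
  qed
  moreover have "wpoly a ls p = g (cell2 a m p)" if "p \<notin> B" for p
    using L(7)[rule_format, OF that] cin by (simp add: hc)
  ultimately show ?thesis using that[of ls B] L(1,2,5) S mB by blast
qed

section \<open>Weighted norms\<close>

definition is_weight :: "(real \<times> real \<Rightarrow> real) \<Rightarrow> bool" where
  "is_weight \<mu> \<longleftrightarrow> \<mu> \<in> borel_measurable LM \<and> (\<forall>p\<in>unit_square. 0 < \<mu> p \<and> \<mu> p \<le> 1)"

text \<open>The complex version of the weighted space is needed even for real targets: the remainders in the
construction contain Walsh functions.\<close>

definition wspace :: "(real \<times> real \<Rightarrow> real) \<Rightarrow> (real \<times> real \<Rightarrow> complex) set" where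
  "wspace \<mu> = {g \<in> borel_measurable LM. integrable LM (\<lambda>p. cmod (g p) * \<mu> p)}"

definition wnorm :: "(real \<times> real \<Rightarrow> real) \<Rightarrow> (real \<times> real \<Rightarrow> complex) \<Rightarrow> real" where
  "wnorm \<mu> g = (LINT p|LM. cmod (g p) * \<mu> p)"

lemma weightD:
  assumes "is_weight \<mu>"
  shows "\<mu> \<in> borel_measurable LM" "p \<in> unit_square \<Longrightarrow> 0 < \<mu> p" "p \<in> unit_square \<Longrightarrow> \<mu> p \<le> 1"
  using assms by (auto simp: is_weight_def)

text \<open>The form in which all estimates of weighted norms are obtained: a pointwise bound almost everywhere by an integrable
function.\<close>

lemma wspace_dominated:
  assumes \<mu>: "is_weight \<mu>" and g: "g \<in> borel_measurable LM" and h: "integrable LM h"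
    and le: "AE p in LM. cmod (g p) * \<mu> p \<le> h p"
  shows "g \<in> wspace \<mu>" "wnorm \<mu> g \<le> integral\<^sup>L LM h"
proof -
  have m: "(\<lambda>p. cmod (g p) * \<mu> p) \<in> borel_measurable LM" using weightD(1)[OF \<mu>] g by simp
  have i: "integrable LM (\<lambda>p. cmod (g p) * \<mu> p)"
  proof (rule Bochner_Integration.integrable_bound[OF h m])
    have "AE p in LM. p \<in> unit_square" by (rule AE_I2) simp
    with le show "AE p in LM. norm (cmod (g p) * \<mu> p) \<le> norm (h p)"
      by eventually_elim (use weightD(2)[OF \<mu>] in \<open>force simp: abs_mult\<close>)
  qed
  then show "g \<in> wspace \<mu>" using g by (simp add: wspace_def)
  show "wnorm \<mu> g \<le> integral\<^sup>L LM h" unfolding wnorm_def by (rule integral_mono_AE[OF i h le])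
qed

lemma wspace_add:
  assumes \<mu>: "is_weight \<mu>" and g: "g \<in> wspace \<mu>" and h: "h \<in> wspace \<mu>"
  shows "(\<lambda>p. g p + h p) \<in> wspace \<mu>" "wnorm \<mu> (\<lambda>p. g p + h p) \<le> wnorm \<mu> g + wnorm \<mu> h"
proof -
  have "AE p in LM. p \<in> unit_square" by (rule AE_I2) simp
  then have le: "AE p in LM. cmod (g p + h p) * \<mu> p \<le> cmod (g p) * \<mu> p + cmod (h p) * \<mu> p"
    by eventually_elim
      (use weightD(2)[OF \<mu>] in \<open>simp add: distrib_right[symmetric] norm_triangle_ineq mult_right_mono less_imp_le\<close>)
  have i: "integrable LM (\<lambda>p. cmod (g p) * \<mu> p + cmod (h p) * \<mu> p)"
    and m: "(\<lambda>p. g p + h p) \<in> borel_measurable LM" using g h by (auto simp: wspace_def)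
  note * = wspace_dominated[OF \<mu> m i le]
  show "(\<lambda>p. g p + h p) \<in> wspace \<mu>" by (rule *(1))
  show "wnorm \<mu> (\<lambda>p. g p + h p) \<le> wnorm \<mu> g + wnorm \<mu> h"
    using *(2) g h by (simp add: wnorm_def wspace_def)
qed

lemma wspace_neg: "g \<in> wspace \<mu> \<Longrightarrow> (\<lambda>p. - g p) \<in> wspace \<mu>" "wnorm \<mu> (\<lambda>p. - g p) = wnorm \<mu> g"
  by (auto simp: wspace_def wnorm_def)

lemma wspace_diff:
  assumes \<mu>: "is_weight \<mu>" and g: "g \<in> wspace \<mu>" and h: "h \<in> wspace \<mu>"
  shows "(\<lambda>p. g p - h p) \<in> wspace \<mu>" "wnorm \<mu> (\<lambda>p. g p - h p) \<le> wnorm \<mu> g + wnorm \<mu> h"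
  using wspace_add[OF \<mu> g wspace_neg(1)[OF h]] by (simp_all add: wspace_neg(2))

lemma wspace_bounded:
  assumes \<mu>: "is_weight \<mu>" and g: "g \<in> borel_measurable LM" and b: "\<And>p. p \<in> unit_square \<Longrightarrow> cmod (g p) \<le> b"
  shows "g \<in> wspace \<mu>"
proof (rule wspace_dominated(1)[OF \<mu> g])
  show "integrable LM (\<lambda>p. b)" by (intro integrable_LM_bounded) auto
  show "AE p in LM. cmod (g p) * \<mu> p \<le> b"
  proof (rule AE_I2)
    fix p assume "p \<in> space LM"
    then have p: "p \<in> unit_square" by simp
    have "cmod (g p) * \<mu> p \<le> cmod (g p) * 1" using weightD[OF \<mu>] p by (intro mult_left_mono) auto
    then show "cmod (g p) * \<mu> p \<le> b" using b[OF p] by simp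
  qed
qed

lemma wnorm_nonneg: "is_weight \<mu> \<Longrightarrow> 0 \<le> wnorm \<mu> g"
  unfolding wnorm_def by (rule integral_nonneg_AE) (auto intro!: AE_I2 dest: weightD(2) intro: less_imp_le)

lemma measure_LM_space: "measure LM (space LM) = 1"
  using emeasure_LM unfolding measure_def by (simp only: enn2real_1)

section \<open>Density of rational step functions\<close>

text \<open>The radial retraction of the plane onto the disc of radius \<open>b\<close>.\<close>

definition radial_clip :: "real \<Rightarrow> complex \<Rightarrow> complex" where
  "radial_clip b z = (b / max b (cmod z)) *\<^sub>R z"

lemma radial_clip_bound: "0 < b \<Longrightarrow> cmod (radial_clip b z) \<le> b"
  by (auto simp: radial_clip_def max_def)

lemma radial_clip_id: "0 < b \<Longrightarrow> cmod z \<le> b \<Longrightarrow> radial_clip b z = z"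
  by (simp add: radial_clip_def max_def)

lemma radial_clip_diff: "0 < b \<Longrightarrow> cmod (radial_clip b z - z) \<le> cmod z"
proof -
  assume b: "0 < b"
  have "radial_clip b z - z = (b / max b (cmod z) - 1) *\<^sub>R z"
    by (simp add: radial_clip_def algebra_simps)
  moreover have "\<bar>b / max b (cmod z) - 1\<bar> \<le> 1"
  proof -
    have "0 \<le> b / max b (cmod z)" "b / max b (cmod z) \<le> 1" using b by (auto simp: divide_le_eq_1 max_def)
    then show ?thesis by linarith
  qed
  ultimately show ?thesis by (simp add: mult_left_le_one_le)
qed

lemma radial_clip_continuous: "0 < b \<Longrightarrow> continuous_on UNIV (radial_clip b)"
  unfolding radial_clip_def by (intro continuous_intros) (auto simp: max_def)

text \<open>The weight may be small, so an element of the weighted space need not be integrable. Truncation reduces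
the approximation to bounded functions, for which the weight can be ignored.\<close>

lemma clip_dense:
  assumes \<mu>: "is_weight \<mu>" and v: "v \<in> wspace \<mu>" and \<delta>: "0 < \<delta>"
  obtains b where "0 < b" "wnorm \<mu> (\<lambda>p. radial_clip b (v p) - v p) < \<delta>"
proof -
  have vm: "v \<in> borel_measurable LM" and vi: "integrable LM (\<lambda>p. cmod (v p) * \<mu> p)" using v by (auto simp: wspace_def)
  have cm: "(\<lambda>p. radial_clip b (v p)) \<in> borel_measurable LM" if "0 < b" for b
    by (rule measurable_compose[OF vm borel_measurable_continuous_onI[OF radial_clip_continuous[OF that]]])
  have "(\<lambda>n. LINT p|LM. cmod (radial_clip (Suc n) (v p) - v p) * \<mu> p) \<longlonglongrightarrow> (LINT p|LM. 0)"
  proof (rule integral_dominated_convergence[OF _ _ vi])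
    show "(\<lambda>p. cmod (radial_clip (Suc n) (v p) - v p) * \<mu> p) \<in> borel_measurable LM" for n
      using cm[of "Suc n"] vm weightD(1)[OF \<mu>] by simp
    show "AE p in LM. (\<lambda>n. cmod (radial_clip (Suc n) (v p) - v p) * \<mu> p) \<longlonglongrightarrow> 0"
    proof (rule AE_I2)
      fix p
      obtain n0 :: nat where "cmod (v p) \<le> n0" using real_arch_simple by blast
      then have "cmod (radial_clip (Suc n) (v p) - v p) * \<mu> p = 0" if "n0 \<le> n" for n
        using that by (subst radial_clip_id) auto
      then show "(\<lambda>n. cmod (radial_clip (Suc n) (v p) - v p) * \<mu> p) \<longlonglongrightarrow> 0"
        by (intro tendsto_eventually) (auto simp: eventually_sequentially)
    qed
    show "AE p in LM. norm (cmod (radial_clip (Suc n) (v p) - v p) * \<mu> p) \<le> cmod (v p) * \<mu> p" for n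
      using weightD(2)[OF \<mu>] radial_clip_diff[of "Suc n"]
      by (intro AE_I2) (auto simp: abs_mult less_imp_le intro!: mult_right_mono)
  qed simp
  then have "(\<lambda>n. wnorm \<mu> (\<lambda>p. radial_clip (Suc n) (v p) - v p)) \<longlonglongrightarrow> 0"
    by (simp add: wnorm_def)
  then have "\<forall>\<^sub>F n in sequentially. wnorm \<mu> (\<lambda>p. radial_clip (Suc n) (v p) - v p) < \<delta>"
    using order_tendstoD(2) \<delta> by blast
  then obtain n where "wnorm \<mu> (\<lambda>p. radial_clip (Suc n) (v p) - v p) < \<delta>" by (auto dest: eventually_happens)
  then show ?thesis using that[of "Suc n"] by simp
qed

lemma AE_LM_interior: "AE p in LM. p \<in> box (0, 0) (1, 1)"
proof -
  have "AE p in lebesgue. p \<notin> cbox (0, 0) (1, 1) - box (0::real, 0::real) (1, 1)"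
    by (rule AE_not_in) (use negligible_frontier_interval negligible_iff_null_sets in blast)
  then show ?thesis
    unfolding unit_square_cbox by (subst AE_restrict_space_iff) (auto elim: eventually_mono)
qed

text \<open>A measurable function is an almost everywhere limit of continuous ones; clipping these at the same radius
makes dominated convergence applicable.\<close>

lemma continuous_dense:
  assumes \<mu>: "is_weight \<mu>" and v: "v \<in> wspace \<mu>" and \<delta>: "0 < \<delta>"
  obtains h b where "continuous_on UNIV h" "\<And>p. cmod (h p) \<le> b" "wnorm \<mu> (\<lambda>p. h p - v p) < \<delta>"
proof -
  have \<delta>2: "0 < \<delta> / 2" using \<delta> by simp
  have vm: "v \<in> borel_measurable LM" using v by (auto simp: wspace_def)
  obtain b where b: "0 < b" "wnorm \<mu> (\<lambda>p. radial_clip b (v p) - v p) < \<delta> / 2"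
    by (rule clip_dense[OF \<mu> v \<delta>2])
  let ?v = "\<lambda>p. radial_clip b (v p)"
  have cm: "radial_clip b \<in> borel_measurable borel"
    by (rule borel_measurable_continuous_onI[OF radial_clip_continuous[OF b(1)]])
  have vm': "?v \<in> borel_measurable LM" by (rule measurable_compose[OF vm cm])
  have "v measurable_on unit_square" using vm by (subst measurable_on_iff_borel_measurable) auto
  then obtain Z g where Z: "negligible Z" and g: "\<And>n. continuous_on UNIV (g n)"
    "\<And>p. p \<notin> Z \<Longrightarrow> (\<lambda>n. g n p) \<longlonglongrightarrow> (if p \<in> unit_square then v p else 0)"
    unfolding measurable_on_def by blast
  let ?g = "\<lambda>n p. radial_clip b (g n p)"
  have gc: "continuous_on UNIV (?g n)" for n
    using continuous_on_compose2[OF radial_clip_continuous[OF b(1)] g(1)] by auto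
  have gm: "?g n \<in> borel_measurable LM" for n
    by (rule borel_LM[OF borel_measurable_continuous_onI[OF gc]])
  have "(\<lambda>n. LINT p|LM. cmod (?g n p - ?v p) * \<mu> p) \<longlonglongrightarrow> (LINT p|LM. 0)"
  proof (rule integral_dominated_convergence[where w="\<lambda>p. 2 * b"])
    show "(\<lambda>p. cmod (?g n p - ?v p) * \<mu> p) \<in> borel_measurable LM" for n
      using gm[of n] vm' weightD(1)[OF \<mu>] by simp
    show "integrable LM (\<lambda>p. 2 * b)" by (intro integrable_LM_bounded) auto
    have "AE p in lebesgue. p \<notin> Z"
      by (rule AE_not_in) (use Z negligible_iff_null_sets in blast)
    then have "AE p in LM. p \<notin> Z \<and> p \<in> unit_square"
      by (subst AE_restrict_space_iff) (auto elim: eventually_mono)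
    then show "AE p in LM. (\<lambda>n. cmod (?g n p - ?v p) * \<mu> p) \<longlonglongrightarrow> 0"
    proof eventually_elim
      case (elim p)
      then have "(\<lambda>n. g n p) \<longlonglongrightarrow> v p" using g(2)[of p] by simp
      moreover have "isCont (radial_clip b) (v p)"
        using radial_clip_continuous[OF b(1)] by (simp add: continuous_on_eq_continuous_at)
      ultimately have "(\<lambda>n. ?g n p) \<longlonglongrightarrow> ?v p" by (rule isCont_tendsto_compose[rotated])
      then have "(\<lambda>n. cmod (?g n p - ?v p) * \<mu> p) \<longlonglongrightarrow> cmod (?v p - ?v p) * \<mu> p"
        by (intro tendsto_intros)
      then show ?case by simp
    qed
    show "AE p in LM. norm (cmod (?g n p - ?v p) * \<mu> p) \<le> 2 * b" for n
    proof (rule AE_I2)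
      fix p assume "p \<in> space LM"
      then have p: "0 \<le> \<mu> p" "\<mu> p \<le> 1" using weightD(2,3)[OF \<mu>, of p] by auto
      have "cmod (?g n p - ?v p) \<le> b + b"
        using radial_clip_bound[OF b(1)] norm_triangle_ineq4[of "?g n p" "?v p"] by (meson add_mono order_trans)
      then have "cmod (?g n p - ?v p) * \<mu> p \<le> (2 * b) * 1" using p b(1) by (intro mult_mono) auto
      then show "norm (cmod (?g n p - ?v p) * \<mu> p) \<le> 2 * b" using p by (simp add: abs_mult)
    qed
  qed simp
  then have "(\<lambda>n. wnorm \<mu> (\<lambda>p. ?g n p - ?v p)) \<longlonglongrightarrow> 0" by (simp add: wnorm_def)
  then have "\<forall>\<^sub>F n in sequentially. wnorm \<mu> (\<lambda>p. ?g n p - ?v p) < \<delta> / 2"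
    using order_tendstoD(2) \<delta>2 by blast
  then obtain n where n: "wnorm \<mu> (\<lambda>p. ?g n p - ?v p) < \<delta> / 2" by (auto dest: eventually_happens)
  have w: "?g n \<in> wspace \<mu>" "?v \<in> wspace \<mu>"
    using gm[of n] vm' radial_clip_bound[OF b(1)] by (auto intro: wspace_bounded[OF \<mu>])
  have "wnorm \<mu> (\<lambda>p. ?g n p - v p) \<le> wnorm \<mu> (\<lambda>p. ?g n p - ?v p) + wnorm \<mu> (\<lambda>p. ?v p - v p)"
    using wspace_add(2)[OF \<mu> wspace_diff(1)[OF \<mu> w] wspace_diff(1)[OF \<mu> w(2) v]] by simp
  then have "wnorm \<mu> (\<lambda>p. ?g n p - v p) < \<delta>" using n b(2) by linarith
  then show ?thesis using that[OF gc[of n], of b] radial_clip_bound[OF b(1)] by blast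
qed

text \<open>The values are taken in the lattice of Gaussian integers divided by \<open>n + 1\<close>, and \<open>n\<close> is at the same time the
level of the subdivision. So the tables are countable and both approximations improve with \<open>n\<close>.\<close>

definition lattice_table :: "nat \<Rightarrow> (int \<times> int) list list \<Rightarrow> nat \<times> nat \<Rightarrow> complex" where
  "lattice_table n l c = (case l ! fst c ! snd c of (u, v) \<Rightarrow> Complex (of_int u / real (Suc n)) (of_int v / real (Suc n)))"

lemma lattice_round:
  "cmod (Complex (of_int \<lfloor>real (Suc n) * Re z\<rfloor> / real (Suc n)) (of_int \<lfloor>real (Suc n) * Im z\<rfloor> / real (Suc n)) - z) \<le> 2 / real (Suc n)"
proof -
  have r: "\<bar>of_int \<lfloor>real (Suc n) * x\<rfloor> / real (Suc n) - x\<bar> \<le> 1 / real (Suc n)" for x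
  proof -
    have "of_int \<lfloor>real (Suc n) * x\<rfloor> / real (Suc n) - x = (of_int \<lfloor>real (Suc n) * x\<rfloor> - real (Suc n) * x) / real (Suc n)"
      by (simp add: field_simps)
    moreover have "\<bar>of_int \<lfloor>real (Suc n) * x\<rfloor> - real (Suc n) * x\<bar> \<le> 1" by linarith
    ultimately show ?thesis by (simp add: divide_right_mono)
  qed
  show ?thesis
    using r[of "Re z"] r[of "Im z"]
    by (intro order_trans[OF cmod_le]) simp
qed

text \<open>The approximation is available at all large levels \<open>n\<close>, not only at one; this provides infinitely many
blocks near every function.\<close>

lemma lattice_dense:
  assumes a: "2 \<le> a" and \<mu>: "is_weight \<mu>" and v: "v \<in> wspace \<mu>" and \<delta>: "0 < \<delta>"
  shows "\<exists>n0. \<forall>n\<ge>n0. \<exists>l. wnorm \<mu> (\<lambda>p. lattice_table n l (cell2 a n p) - v p) < \<delta>"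
proof -
  have \<delta>2: "0 < \<delta> / 2" "0 < \<delta> / 8" using \<delta> by simp_all
  obtain h b where h: "continuous_on UNIV h" "\<And>p. cmod (h p) \<le> b" "wnorm \<mu> (\<lambda>p. h p - v p) < \<delta> / 2"
    using continuous_dense[OF \<mu> v \<delta>2(1)] by blast
  have hw: "h \<in> wspace \<mu>"
    using h(2) by (intro wspace_bounded[OF \<mu> borel_LM[OF borel_measurable_continuous_onI[OF h(1)]]])
  have "uniformly_continuous_on unit_square h"
    unfolding unit_square_cbox by (intro compact_uniformly_continuous continuous_on_subset[OF h(1)]) auto
  then obtain d where d: "0 < d" "\<And>p q. p \<in> unit_square \<Longrightarrow> q \<in> unit_square \<Longrightarrow> dist q p < d \<Longrightarrow> dist (h q) (h p) < \<delta> / 8"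
    unfolding uniformly_continuous_on_def using \<delta>2(2) by blast
  have a1: "1 < real a" using a by linarith
  have "(\<lambda>n. 2 / real a ^ n) \<longlonglongrightarrow> 0"
    by (rule tendsto_divide_0[OF tendsto_const filterlim_realpow_sequentially_gt1]) (use a1 in auto)
  then have e1: "\<forall>\<^sub>F n in sequentially. 2 / real a ^ n < d" using d(1) order_tendstoD(2) by blast
  have "(\<lambda>n. 2 * inverse (real (Suc n))) \<longlonglongrightarrow> 0" by (intro tendsto_mult_right_zero LIMSEQ_inverse_real_of_nat)
  from order_tendstoD(2)[OF this \<delta>2(2)]
  have e2: "\<forall>\<^sub>F n in sequentially. 2 / real (Suc n) < \<delta> / 8" by (simp only: divide_inverse)
  obtain n0 where n0: "\<And>n. n0 \<le> n \<Longrightarrow> 2 / real a ^ n < d" "\<And>n. n0 \<le> n \<Longrightarrow> 2 / real (Suc n) < \<delta> / 8"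
    using eventually_conj[OF e1 e2] unfolding eventually_sequentially by blast
  have "\<exists>l. wnorm \<mu> (\<lambda>p. lattice_table n l (cell2 a n p) - v p) < \<delta>" if n: "n0 \<le> n" for n
  proof -
    define c where "c k j = (real k / real a ^ n, real j / real a ^ n)" for k j
    define l where "l = map (\<lambda>k. map (\<lambda>j. (\<lfloor>real (Suc n) * Re (h (c k j))\<rfloor>, \<lfloor>real (Suc n) * Im (h (c k j))\<rfloor>)) [0..<a ^ n]) [0..<a ^ n]"
    let ?F = "\<lambda>p. lattice_table n l (cell2 a n p)"
    have Fm: "?F \<in> borel_measurable LM"
      by (rule borel_LM) measurable
    have near: "cmod (?F p - h p) \<le> \<delta> / 4" if p: "p \<in> box (0, 0) (1, 1)" for p
    proof -
      obtain x y where xy: "p = (x, y)" "0 < x" "x < 1" "0 < y" "y < 1" using p by (cases p) (auto simp: box_def Basis_prod_def)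
      define k where "k = cell a n x" define j where "j = cell a n y"
      have an: "0 < real a ^ n" using a by simp
      have cl: "0 \<le> real (cell a n z) / real a ^ n \<and> real (cell a n z) / real a ^ n \<le> z \<and> z - real (cell a n z) / real a ^ n \<le> 1 / real a ^ n"
        if "0 < z" "z < 1" for z
      proof -
        have "frac z = z" using that by (simp add: frac_eq)
        then have *: "real (cell a n z) \<le> real a ^ n * z" "real a ^ n * z - real (cell a n z) \<le> 1"
          using cell_bounds[of a n z] by simp_all
        have "z - real (cell a n z) / real a ^ n = (real a ^ n * z - real (cell a n z)) / real a ^ n"
          using an by (simp add: field_simps)
        also have "\<dots> \<le> 1 / real a ^ n" using *(2) an by (intro divide_right_mono) auto
        finally show ?thesis using *(1) an by (simp add: divide_le_eq mult.commute)
      qed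
      have c1: "c k j \<in> unit_square"
        using cl[of x] cl[of y] xy by (auto simp: c_def k_def j_def unit_square_def)
      have "dist (c k j) p \<le> dist (real k / real a ^ n) x + dist (real j / real a ^ n) y"
        unfolding c_def xy(1) dist_Pair_Pair by (rule sqrt_sum_squares_le_sum) auto
      also have "\<dots> \<le> 1 / real a ^ n + 1 / real a ^ n"
        using cl[of x] cl[of y] xy by (auto simp: dist_real_def k_def j_def)
      also have "\<dots> < d" using n0(1)[OF n] by simp
      finally have "dist (c k j) p < d" .
      moreover have "p \<in> unit_square" using xy by (auto simp: unit_square_def)
      ultimately have 1: "cmod (h (c k j) - h p) < \<delta> / 8" using d(2) c1 by (simp add: dist_norm)
      have "?F p = Complex (of_int \<lfloor>real (Suc n) * Re (h (c k j))\<rfloor> / real (Suc n)) (of_int \<lfloor>real (Suc n) * Im (h (c k j))\<rfloor> / real (Suc n))"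
        using cell_less[OF a, of n x] cell_less[OF a, of n y]
        by (simp add: lattice_table_def l_def cell2_def xy(1) k_def j_def)
      then have 2: "cmod (?F p - h (c k j)) \<le> 2 / real (Suc n)" using lattice_round[of n "h (c k j)"] by simp
      show ?thesis
        using norm_triangle_ineq[of "?F p - h (c k j)" "h (c k j) - h p"] 1 2 n0(2)[OF n] by simp
    qed
    have "AE p in LM. cmod (?F p - h p) * \<mu> p \<le> \<delta> / 4"
    proof -
      have "AE p in LM. p \<in> unit_square" by (rule AE_I2) simp
      with AE_LM_interior show ?thesis
      proof eventually_elim
        case (elim p)
        then have "cmod (?F p - h p) * \<mu> p \<le> (\<delta> / 4) * 1"
          using near weightD(2,3)[OF \<mu>, of p] \<delta> by (intro mult_mono) auto
        then show ?case by simp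
      qed
    qed
    moreover have "integrable LM (\<lambda>p. \<delta> / 4)" by (intro integrable_LM_bounded[where B="\<bar>\<delta> / 4\<bar>"]) auto
    moreover have "(\<lambda>p. ?F p - h p) \<in> borel_measurable LM"
      using hw by (intro borel_measurable_diff[OF Fm]) (simp add: wspace_def)
    ultimately have F: "(\<lambda>p. ?F p - h p) \<in> wspace \<mu>" "wnorm \<mu> (\<lambda>p. ?F p - h p) \<le> \<delta> / 4"
      using wspace_dominated[OF \<mu>, of "\<lambda>p. ?F p - h p" "\<lambda>p. \<delta> / 4"] measure_LM_space by auto
    have "wnorm \<mu> (\<lambda>p. ?F p - v p) \<le> wnorm \<mu> (\<lambda>p. ?F p - h p) + wnorm \<mu> (\<lambda>p. h p - v p)"
      using wspace_add(2)[OF \<mu> F(1) wspace_diff(1)[OF \<mu> hw v]] by simp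
    then have "wnorm \<mu> (\<lambda>p. ?F p - v p) < \<delta>" using F(2) h(3) \<delta> by linarith
    then show ?thesis by blast
  qed
  then show ?thesis by blast
qed

section \<open>The weight\<close>

text \<open>Let \<open>W\<close> be the sum of \<open>2\<^sup>k D\<^sub>k\<close> over all \<open>k \<ge> K\<close> for which the point lies in \<open>B\<^sub>k\<close>, and take \<open>1 / (1 + W)\<close> as the weight. By the
Borel--Cantelli lemma \<open>W\<close> is finite almost everywhere.\<close>

lemma weight_exists:
  assumes B: "\<And>k. B k \<in> sets borel" "\<And>k. measure LM (B k \<inter> unit_square) \<le> (1/2) ^ k"
    and D: "\<And>k. 0 \<le> D k" and \<epsilon>: "0 < \<epsilon>"
  shows "\<exists>\<mu> K. is_weight \<mu> \<and> measure lebesgue {p \<in> unit_square. \<mu> p \<noteq> 1} < \<epsilon> \<and>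
    (\<forall>k\<ge>K. AE p in LM. p \<in> B k \<longrightarrow> D k * \<mu> p \<le> (1/2) ^ k)"
proof -
  have "(\<lambda>n. 2 * (1/2) ^ n :: real) \<longlonglongrightarrow> 0" by (intro tendsto_mult_right_zero LIMSEQ_realpow_zero) auto
  from order_tendstoD(2)[OF this \<epsilon>] have "\<forall>\<^sub>F n in sequentially. 2 * (1/2) ^ n < \<epsilon>" .
  then obtain K where K: "2 * (1/2) ^ K < \<epsilon>" by (auto dest: eventually_happens)
  define A where "A i = B (i + K) \<inter> unit_square" for i
  have A: "A i \<in> sets LM" for i unfolding A_def by (rule borel_LM_sets[OF B(1)])
  define W where "W p = (\<Sum>i. ennreal (2 ^ (i + K) * D (i + K)) * indicator (A i) p)" for p
  have Wm: "W \<in> borel_measurable LM"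
    unfolding W_def using A by measurable
  \<comment> \<open>where \<open>W\<close> is infinite the value 1 merely keeps the weight positive\<close>
  define \<mu> where "\<mu> p = (if W p = \<infinity> then 1 else 1 / (1 + enn2real (W p)))" for p
  have \<mu>m: "\<mu> \<in> borel_measurable LM"
    unfolding \<mu>_def using Wm by measurable
  have w: "is_weight \<mu>"
    using \<mu>m by (auto simp: is_weight_def \<mu>_def divide_le_eq add_pos_nonneg intro!: divide_pos_pos)
  have fin: "finite_measure LM" by (rule finite_measure_LM)
  have fA: "A i \<in> fmeasurable LM" for i
    using A finite_measure.fmeasurable_eq_sets[OF fin] by blast
  have bound: "measure LM (A i) \<le> (1/2) ^ K * (1/2) ^ i" for i
    using B(2)[of "i + K"] by (simp add: A_def power_add mult.commute)
  have un: "measure LM (\<Union>i. A i) \<le> 2 * (1/2) ^ K"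
  proof (rule measure_countable_Union_le[OF fA])
    fix n
    have "measure LM (\<Union>i\<le>n. A i) \<le> (\<Sum>i\<le>n. measure LM (A i))" by (rule measure_UNION_le) (auto intro: A)
    also have "(\<Sum>i\<le>n. measure LM (A i)) \<le> (\<Sum>i\<le>n. (1/2) ^ K * (1/2) ^ i)" by (intro sum_mono bound)
    also have "\<dots> = (1/2) ^ K * (\<Sum>i\<le>n. (1/2) ^ i)" by (simp add: sum_distrib_left)
    also have "\<dots> \<le> (1/2) ^ K * 2" by (intro mult_left_mono) (simp_all add: sum_gp0)
    finally show "measure LM (\<Union>i\<le>n. A i) \<le> 2 * (1/2) ^ K" by simp
  qed
  have sub: "{p \<in> unit_square. \<mu> p \<noteq> 1} \<subseteq> (\<Union>i. A i)"
  proof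
    fix p assume p: "p \<in> {p \<in> unit_square. \<mu> p \<noteq> 1}"
    show "p \<in> (\<Union>i. A i)"
    proof (rule ccontr)
      assume "p \<notin> (\<Union>i. A i)"
      then have "W p = 0" by (simp add: W_def)
      then show False using p by (simp add: \<mu>_def)
    qed
  qed
  have "(\<Union>i. A i) \<in> sets LM" using A by (intro sets.countable_UN) auto
  then have "measure LM {p \<in> unit_square. \<mu> p \<noteq> 1} \<le> measure LM (\<Union>i. A i)"
    by (rule finite_measure.finite_measure_mono[OF fin sub])
  then have "measure LM {p \<in> unit_square. \<mu> p \<noteq> 1} < \<epsilon>" using un K by linarith
  moreover have "measure LM {p \<in> unit_square. \<mu> p \<noteq> 1} = measure lebesgue {p \<in> unit_square. \<mu> p \<noteq> 1}"
    by (rule measure_restrict_space) auto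
  ultimately have m: "measure lebesgue {p \<in> unit_square. \<mu> p \<noteq> 1} < \<epsilon>" by simp
  have "AE p in LM. eventually (\<lambda>i. p \<in> space LM - A i) sequentially"
  proof (rule borel_cantelli_AE1[OF A])
    show "emeasure LM (A n) < \<infinity>" for n using finite_measure.emeasure_finite[OF fin, of "A n"] by (simp add: less_top)
    show "summable (\<lambda>n. measure LM (A n))"
    proof (rule summable_comparison_test')
      show "summable (\<lambda>n. (1/2) ^ K * (1/2::real) ^ n)" by (intro summable_mult summable_geometric) auto
      show "norm (measure LM (A n)) \<le> (1/2) ^ K * (1/2) ^ n" if "0 \<le> n" for n using bound[of n] by simp
    qed
  qed
  then have Wfin: "AE p in LM. W p \<noteq> \<infinity>"
  proof eventually_elim
    case (elim p)
    then obtain n where n: "\<And>i. n \<le> i \<Longrightarrow> p \<notin> A i" by (auto simp: eventually_sequentially)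
    have "W p = (\<Sum>i<n. ennreal (2 ^ (i + K) * D (i + K)) * indicator (A i) p)"
      unfolding W_def by (rule suminf_finite) (use n in \<open>auto simp: not_less\<close>)
    also have "\<dots> < \<infinity>" by (simp add: ennreal_mult_less_top indicator_def)
    finally show ?case by simp
  qed
  have "AE p in LM. p \<in> B k \<longrightarrow> D k * \<mu> p \<le> (1/2) ^ k" if k: "K \<le> k" for k
  proof -
    have "AE p in LM. p \<in> unit_square" by (rule AE_I2) simp
    with Wfin show ?thesis
    proof eventually_elim
      case (elim p)
      show ?case
      proof
        assume pB: "p \<in> B k"
        obtain i where i: "k = i + K" using k by (metis le_add_diff_inverse2)
        define f where "f i = ennreal (2 ^ (i + K) * D (i + K)) * indicator (A i) p" for i
        have "ennreal (2 ^ k * D k) = sum f {i}"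
          using pB elim by (simp add: A_def i f_def)
        also have "\<dots> \<le> W p"
          unfolding W_def f_def[symmetric] by (rule sum_le_suminf) auto
        finally have "enn2real (ennreal (2 ^ k * D k)) \<le> enn2real (W p)"
          using elim by (intro enn2real_mono) (auto simp: less_top)
        then have "2 ^ k * D k \<le> enn2real (W p)" using D[of k] by simp
        then have "D k \<le> (1/2) ^ k * (1 + enn2real (W p))" by (simp add: field_simps power_divide)
        then have "D k / (1 + enn2real (W p)) \<le> (1/2) ^ k"
          by (subst pos_divide_le_eq) (auto simp: add_pos_nonneg)
        then show "D k * \<mu> p \<le> (1/2) ^ k" using elim by (simp add: \<mu>_def)
      qed
    qed
  qed
  then show ?thesis using w m by (intro exI[of _ \<mu>] exI[of _ K]) simp
qed

section \<open>Rearranging a series that consists of blocks\<close>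

text \<open>The series is listed by a growing sequence of finite lists. The \<open>n\<close>-th step appends the \<open>n\<close>-th element of an
enumeration of \<open>I\<close>, unless it has already been listed, which makes the listing exhaustive, and then a block that corrects the
remaining difference to within \<open>C / 2\<^sup>n\<^sup>+\<^sup>1\<close>. While a block is being listed, the distance to \<open>v\<close> is at most
twice the difference it corrects plus its tolerance, and that difference is bounded by the previous error and the norm of the single term.\<close>

lemma rearrangement_of_blocks:
  fixes t :: "'i::countable \<Rightarrow> 'v::ab_group_add" and N :: "'v \<Rightarrow> real"
  assumes I: "infinite I"
    and t: "\<And>i. i \<in> I \<Longrightarrow> t i \<in> V"
    and V0: "0 \<in> V" and Vadd: "\<And>u w. u \<in> V \<Longrightarrow> w \<in> V \<Longrightarrow> u + w \<in> V" and Vneg: "\<And>u. u \<in> V \<Longrightarrow> - u \<in> V"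
    and N0: "N 0 = 0" and Npos: "\<And>u. 0 \<le> N u" and Nadd: "\<And>u w. u \<in> V \<Longrightarrow> w \<in> V \<Longrightarrow> N (u + w) \<le> N u + N w"
    and Nneg: "\<And>u. N (- u) = N u"
    and small: "\<And>\<delta>. 0 < \<delta> \<Longrightarrow> finite {i \<in> I. \<delta> \<le> N (t i)}"
    and blocks: "\<And>u \<delta> A. u \<in> V \<Longrightarrow> 0 < \<delta> \<Longrightarrow> finite A \<Longrightarrow>
      \<exists>l. distinct l \<and> set l \<subseteq> I - A \<and> N ((\<Sum>i\<leftarrow>l. t i) - u) \<le> \<delta> \<and> (\<forall>j. N (\<Sum>i\<leftarrow>take j l. t i) \<le> N u + \<delta>)"
    and v: "v \<in> V"
  shows "\<exists>\<tau>. bij_betw \<tau> UNIV I \<and> (\<lambda>n. N ((\<Sum>j<n. t (\<tau> j)) - v)) \<longlonglongrightarrow> 0"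
proof -
  define e where "e = from_nat_into I"
  have e: "bij_betw e UNIV I" unfolding e_def by (rule bij_betw_from_nat_into[OF _ I]) auto
  define S where "S l = (\<Sum>i\<leftarrow>l. t i)" for l
  have S_app: "S (l @ l') = S l + S l'" for l l' by (simp add: S_def)
  have SV: "S l \<in> V" if "set l \<subseteq> I" for l
    using that by (induction l) (auto simp: S_def V0 Vadd t)
  have Vdiff: "u - w \<in> V" if "u \<in> V" "w \<in> V" for u w
    using Vadd[OF that(1) Vneg[OF that(2)]] by simp
  define C where "C = N v + 1"
  have C: "0 < C" using Npos[of v] by (simp add: C_def)
  \<comment> \<open>bounds the distance to \<open>v\<close> during the whole \<open>n\<close>-th step\<close>
  define b where "b n = 3 * C * (1/2) ^ n + 2 * N (t (e n))" for n
  define P where "P n L \<longleftrightarrow> distinct L \<and> set L \<subseteq> I \<and> N (S L - v) \<le> C * (1/2) ^ n" for n L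
  define Q where "Q n L L' \<longleftrightarrow> e n \<in> set L' \<and> (\<exists>w. L' = L @ w \<and> (\<forall>j. N (S (L @ take j w) - v) \<le> b n))" for n L L'
  have "\<exists>L. \<forall>n. P n (L n) \<and> Q n (L n) (L (Suc n))"
  proof (rule dependent_nat_choice)
    show "\<exists>L. P 0 L"
      using Nneg[of v] by (intro exI[of _ "[]"]) (simp add: P_def S_def C_def)
  next
    fix L n assume PL: "P n L"
    have q: "0 \<le> C * (1/2) ^ n" using C by simp
    define x where "x = (if e n \<in> set L then [] else [e n])"
    have en: "e n \<in> I" using e by (auto simp: bij_betw_def)
    have LI: "set L \<subseteq> I" "distinct L" and LN: "N (S L - v) \<le> C * (1/2) ^ n" using PL by (auto simp: P_def)
    have xI: "set x \<subseteq> I" using en by (simp add: x_def)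
    have Nx: "N (S x) \<le> N (t (e n))" using N0 Npos by (simp add: x_def S_def)
    define u where "u = v - S (L @ x)"
    have LxI: "set (L @ x) \<subseteq> I" using LI xI by simp
    have uV: "u \<in> V" unfolding u_def by (rule Vdiff[OF v SV[OF LxI]])
    have "- u = (S L - v) + S x" by (simp add: u_def S_app)
    then have "N u \<le> N (S L - v) + N (S x)"
      using Nadd[OF Vdiff[OF SV[OF LI(1)] v] SV[OF xI]] Nneg[of u] by simp
    then have Nu: "N u \<le> C * (1/2) ^ n + N (t (e n))" using LN Nx by linarith
    have d0: "0 < C * (1/2) ^ Suc n" using C by simp
    obtain l where l: "distinct l" "set l \<subseteq> I - set (L @ x)" "N (S l - u) \<le> C * (1/2) ^ Suc n"
      "\<And>j. N (S (take j l)) \<le> N u + C * (1/2) ^ Suc n"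
      using blocks[OF uV d0, of "set (L @ x)"] unfolding S_def by auto
    have "S (L @ x @ l) - v = S l - u" by (simp add: u_def S_app)
    then have "P (Suc n) (L @ x @ l)"
      using l LI xI by (auto simp: P_def x_def)
    moreover have "Q n L (L @ x @ l)"
    proof -
      have "N (S (L @ take j (x @ l)) - v) \<le> b n" for j
      proof (cases "j < length x")
        case True
        then have t: "take j (x @ l) = []" by (auto simp: x_def split: if_splits)
        show ?thesis unfolding t b_def append_Nil2 using LN Npos[of "t (e n)"] q by linarith
      next
        case False
        let ?y = "take (j - length x) l"
        have "S (L @ take j (x @ l)) - v = S ?y + - u" using False by (simp add: u_def S_app)
        moreover have "set ?y \<subseteq> I" using l(2) set_take_subset[of "j - length x" l] by blast
        ultimately have "N (S (L @ take j (x @ l)) - v) \<le> N (S ?y) + N u"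
          using Nadd[OF SV Vneg[OF uV], of ?y] Nneg[of u] by simp
        also have "\<dots> \<le> (N u + C * (1/2) ^ Suc n) + N u" using l(4) by simp
        also have "\<dots> \<le> b n" unfolding b_def power_Suc using Nu q by linarith
        finally show ?thesis .
      qed
      moreover have "e n \<in> set (L @ x @ l)" by (simp add: x_def)
      ultimately show ?thesis unfolding Q_def by blast
    qed
    ultimately show "\<exists>L'. P (Suc n) L' \<and> Q n L L'" by blast
  qed
  then obtain L where LP: "\<And>n. P n (L n)" and LQ: "\<And>n. Q n (L n) (L (Suc n))" by blast
  have ext: "\<exists>w. L (m + k) = L m @ w" for m k
  proof (induction k)
    case (Suc k)
    then obtain w where "L (m + k) = L m @ w" ..
    moreover obtain w' where "L (Suc (m + k)) = L (m + k) @ w'" using LQ[of "m + k"] by (auto simp: Q_def)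
    ultimately show ?case by simp
  qed simp
  have ext': "\<exists>w. L n = L m @ w" if "m \<le> n" for m n
    using ext[of m "n - m"] that by simp
  have mono: "length (L m) \<le> length (L n)" if "m \<le> n" for m n
    using ext'[OF that] by auto
  have mem: "e k \<in> set (L n)" if "k < n" for k n
    using LQ[of k] ext'[of "Suc k" n] that by (auto simp: Q_def)
  have dist: "distinct (L n)" and subI: "set (L n) \<subseteq> I" for n using LP[of n] by (auto simp: P_def)
  have len: "n \<le> length (L n)" for n
  proof -
    have "n = card (e ` {..<n})" using e by (simp add: card_image bij_betw_def inj_on_subset[of e UNIV])
    also have "\<dots> \<le> card (set (L n))" using mem by (intro card_mono) auto
    also have "\<dots> = length (L n)" by (rule distinct_card[OF dist])
    finally show ?thesis .
  qed
  define \<tau> where "\<tau> j = L (Suc j) ! j" for j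
  have \<tau>: "\<tau> j = L n ! j" if "j < length (L n)" for j n
  proof (cases "n \<le> Suc j")
    case True
    then show ?thesis using ext'[OF True] that by (auto simp: \<tau>_def nth_append)
  next
    case False
    then have "Suc j \<le> n" by simp
    then show ?thesis using ext'[of "Suc j" n] len[of "Suc j"] by (auto simp: \<tau>_def nth_append)
  qed
  have sum_eq: "(\<Sum>i<j. t (\<tau> i)) = S (take j (L n))" if "j \<le> length (L n)" for j n
  proof -
    have "take j (L n) = map \<tau> [0..<j]"
      using that \<tau>[of _ n] by (intro nth_equalityI) auto
    then show ?thesis by (simp add: S_def comp_def interv_sum_list_conv_sum_set_nat lessThan_atLeast0)
  qed
  have "bij_betw \<tau> UNIV I"
  proof (rule bij_betwI')
    fix i j
    let ?n = "Suc (max i j)"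
    have "i < length (L ?n)" "j < length (L ?n)" using len[of ?n] by auto
    then show "\<tau> i = \<tau> j \<longleftrightarrow> i = j"
      using \<tau>[of i ?n] \<tau>[of j ?n] nth_eq_iff_index_eq[OF dist] by auto
  next
    fix j :: nat
    have "j < length (L (Suc j))" using len[of "Suc j"] by simp
    then show "\<tau> j \<in> I" using \<tau>[of j "Suc j"] subI[of "Suc j"] nth_mem by fastforce
  next
    fix i assume "i \<in> I"
    then obtain k where "i = e k" using e by (auto simp: bij_betw_def)
    then have "i \<in> set (L (Suc k))" using mem[of k "Suc k"] by simp
    then obtain j where "j < length (L (Suc k))" "i = L (Suc k) ! j" by (metis in_set_conv_nth)
    then show "\<exists>j\<in>UNIV. i = \<tau> j" using \<tau>[of j "Suc k"] by (intro bexI[of _ j]) simp_all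
  qed
  moreover have "(\<lambda>n. N ((\<Sum>j<n. t (\<tau> j)) - v)) \<longlonglongrightarrow> 0"
  proof (rule LIMSEQ_I)
    fix r :: real assume r: "0 < r"
    have "(\<lambda>n. N (t (e n))) \<longlonglongrightarrow> 0"
    proof (rule LIMSEQ_I)
      fix s :: real assume "0 < s"
      then have "finite (e -` {i \<in> I. s \<le> N (t i)})"
        using e small by (intro finite_vimageI) (auto simp: bij_betw_def)
      then obtain n0 where "\<And>n. n \<in> e -` {i \<in> I. s \<le> N (t i)} \<Longrightarrow> n < n0"
        by (auto simp: finite_nat_iff_bounded)
      moreover have "e n \<in> I" for n using e by (auto simp: bij_betw_def)
      ultimately show "\<exists>n0. \<forall>n\<ge>n0. norm (N (t (e n)) - 0) < s"
        using Npos by (intro exI[of _ n0]) (force simp: not_le[symmetric])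
    qed
    then have "b \<longlonglongrightarrow> 3 * C * 0 + 2 * 0"
      unfolding b_def by (intro tendsto_intros LIMSEQ_realpow_zero) auto
    then have "\<forall>\<^sub>F n in sequentially. b n < r" using order_tendstoD(2)[of b 0 _ r] r by simp
    then obtain n0 where n0: "\<And>n. n0 \<le> n \<Longrightarrow> b n < r" by (auto simp: eventually_sequentially)
    have "N ((\<Sum>i<j. t (\<tau> i)) - v) < r" if j: "length (L n0) \<le> j" for j
    proof -
      \<comment> \<open>the step during which the \<open>j\<close>-th term is listed\<close>
      define n where "n = (LEAST n. j < length (L (Suc n)))"
      have ex: "j < length (L (Suc j))" using len[of "Suc j"] by simp
      have n1: "j < length (L (Suc n))" unfolding n_def by (rule LeastI[where P="\<lambda>n. j < length (L (Suc n))", OF ex])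
      have "n0 \<le> n"
      proof (rule ccontr)
        assume "\<not> n0 \<le> n"
        then have "length (L (Suc n)) \<le> length (L n0)" by (intro mono) simp
        then show False using n1 j by simp
      qed
      have n2: "length (L n) \<le> j"
      proof (cases "n = n0")
        case False
        then obtain m where m: "n = Suc m" using \<open>n0 \<le> n\<close> by (cases n) auto
        then have "m < n" by simp
        then have "\<not> j < length (L (Suc m))" unfolding n_def by (rule not_less_Least)
        then show ?thesis by (simp add: m)
      qed (use j in simp)
      obtain w where w: "L (Suc n) = L n @ w" "\<And>j. N (S (L n @ take j w) - v) \<le> b n"
        using LQ[of n] by (auto simp: Q_def)
      have "(\<Sum>i<j. t (\<tau> i)) = S (L n @ take (j - length (L n)) w)"
        using sum_eq[of j "Suc n"] n1 n2 w(1) by simp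
      then show ?thesis using w(2)[of "j - length (L n)"] n0[OF \<open>n0 \<le> n\<close>] by simp
    qed
    then show "\<exists>no. \<forall>n\<ge>no. norm (N ((\<Sum>j<n. t (\<tau> j)) - v) - 0) < r"
      using Npos by (intro exI[of _ "length (L n0)"]) auto
  qed
  ultimately show ?thesis by blast
qed

text \<open>The diagonal receives the terms of the single series, and the off-diagonal positions receive the zero
terms; the off-diagonal positions and the indices outside \<open>I\<close> are both countably infinite, so a bijection between
them exists.\<close>

lemma diagonal_rearrangement:
  fixes g :: "nat \<times> nat \<Rightarrow> real \<times> real \<Rightarrow> complex"
  assumes I: "I \<subseteq> pos_pairs" "infinite (pos_pairs - I)"
    and \<tau>: "bij_betw \<tau> UNIV I" and g: "\<And>i p. i \<in> pos_pairs - I \<Longrightarrow> g i p = 0"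
  obtains \<sigma> where "bij_betw \<sigma> pos_pairs pos_pairs"
    "\<And>n m p. rect_sum (g \<circ> \<sigma>) (n, m) p = (\<Sum>j<min n m. g (\<tau> j) p)"
    "\<And>R p. spherical_sum (g \<circ> \<sigma>) R p = (\<Sum>j<nat \<lfloor>\<bar>R\<bar> / sqrt 2\<rfloor>. g (\<tau> j) p)"
proof -
  define D where "D = (\<lambda>j. (Suc j, Suc j)) ` (UNIV :: nat set)"
  have D: "D \<subseteq> pos_pairs" by (auto simp: D_def pos_pairs_def)
  have "(\<lambda>j. (1, Suc (Suc j))) ` (UNIV :: nat set) \<subseteq> pos_pairs - D"
    by (auto simp: D_def pos_pairs_def)
  moreover have "infinite ((\<lambda>j. (1::nat, Suc (Suc j))) ` (UNIV :: nat set))"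
    by (subst finite_image_iff) (auto simp: inj_on_def)
  ultimately have inf: "infinite (pos_pairs - D)" using finite_subset by blast
  have cnt: "countable (pos_pairs - D)" "countable (pos_pairs - I)" by auto
  define \<beta> where "\<beta> = from_nat_into (pos_pairs - I) \<circ> to_nat_on (pos_pairs - D)"
  have \<beta>: "bij_betw \<beta> (pos_pairs - D) (pos_pairs - I)"
    unfolding \<beta>_def
    by (rule bij_betw_trans[OF to_nat_on_infinite[OF cnt(1) inf] bij_betw_from_nat_into[OF cnt(2) I(2)]])
  define \<sigma> where "\<sigma> i = (if i \<in> D then \<tau> (fst i - 1) else \<beta> i)" for i
  have "bij_betw (\<lambda>i. \<tau> (fst i - 1)) D I"
  proof -
    have "bij_betw (\<lambda>i. fst i - 1) D UNIV"
      by (rule bij_betw_byWitness[where f'="\<lambda>j. (Suc j, Suc j)"]) (auto simp: D_def)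
    from bij_betw_trans[OF this \<tau>] show ?thesis by (simp add: comp_def)
  qed
  then have "bij_betw \<sigma> D I" by (rule bij_betw_cong[THEN iffD1, rotated]) (simp add: \<sigma>_def)
  moreover have "bij_betw \<sigma> (pos_pairs - D) (pos_pairs - I)"
    by (rule bij_betw_cong[THEN iffD1, OF _ \<beta>]) (simp add: \<sigma>_def)
  ultimately have "bij_betw \<sigma> (D \<union> (pos_pairs - D)) (I \<union> (pos_pairs - I))"
    by (rule bij_betw_combine) auto
  then have bij: "bij_betw \<sigma> pos_pairs pos_pairs" using D I(1) by (simp add: Un_absorb1)
  have diag: "(g \<circ> \<sigma>) (Suc j, Suc j) p = g (\<tau> j) p" for j p by (simp add: \<sigma>_def D_def)
  have off: "(g \<circ> \<sigma>) i p = 0" if "i \<in> pos_pairs" "i \<notin> D" for i p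
  proof -
    have "\<beta> i \<in> pos_pairs - I" using \<beta> that by (auto simp: bij_betw_def)
    then show ?thesis using that g by (simp add: \<sigma>_def)
  qed
  have rect: "rect_sum (g \<circ> \<sigma>) (n, m) p = (\<Sum>j<min n m. g (\<tau> j) p)" for n m p
  proof -
    have "rect_sum (g \<circ> \<sigma>) (n, m) p = (\<Sum>i\<in>{1..n} \<times> {1..m}. (g \<circ> \<sigma>) i p)"
      by (simp add: rect_sum_def sum.cartesian_product)
    also have "\<dots> = (\<Sum>i\<in>(\<lambda>j. (Suc j, Suc j)) ` {..<min n m}. (g \<circ> \<sigma>) i p)"
    proof (rule sum.mono_neutral_right)
      show "\<forall>i\<in>{1..n} \<times> {1..m} - (\<lambda>j. (Suc j, Suc j)) ` {..<min n m}. (g \<circ> \<sigma>) i p = 0"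
      proof
        fix i assume i: "i \<in> {1..n} \<times> {1..m} - (\<lambda>j. (Suc j, Suc j)) ` {..<min n m}"
        then have "i \<in> pos_pairs" by (auto simp: pos_pairs_def)
        moreover have "i \<notin> D" using i by (auto simp: D_def)
        ultimately show "(g \<circ> \<sigma>) i p = 0" by (rule off)
      qed
    qed auto
    also have "\<dots> = (\<Sum>j<min n m. g (\<tau> j) p)"
      by (subst sum.reindex) (auto simp: inj_on_def diag[unfolded comp_apply] intro!: sum.cong)
    finally show ?thesis .
  qed
  have sph: "spherical_sum (g \<circ> \<sigma>) R p = (\<Sum>j<nat \<lfloor>\<bar>R\<bar> / sqrt 2\<rfloor>. g (\<tau> j) p)" for R p
  proof -
    let ?r = "nat \<lfloor>\<bar>R\<bar> / sqrt 2\<rfloor>"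
    have mem: "(Suc j, Suc j) \<in> disc_indices R \<longleftrightarrow> j < ?r" for j
    proof -
      have "(Suc j, Suc j) \<in> disc_indices R \<longleftrightarrow> 2 * (real (Suc j))\<^sup>2 \<le> R\<^sup>2"
        by (simp add: disc_indices_def pos_pairs_def)
      also have "\<dots> \<longleftrightarrow> (sqrt 2 * real (Suc j))\<^sup>2 \<le> \<bar>R\<bar>\<^sup>2"
        by (simp add: power_mult_distrib)
      also have "\<dots> \<longleftrightarrow> sqrt 2 * real (Suc j) \<le> \<bar>R\<bar>"
        by (rule power2_le_iff_abs_le[THEN trans]) auto
      also have "\<dots> \<longleftrightarrow> real (Suc j) \<le> \<bar>R\<bar> / sqrt 2"
        by (subst pos_le_divide_eq) (auto simp: mult.commute)
      also have "\<dots> \<longleftrightarrow> Suc j \<le> ?r"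
        by (metis divide_nonneg_nonneg abs_ge_zero le_nat_floor nat_le_real_less of_nat_floor order_trans of_nat_le_iff real_sqrt_ge_zero zero_le_numeral)
      finally show ?thesis by auto
    qed
    have "spherical_sum (g \<circ> \<sigma>) R p = (\<Sum>i\<in>(\<lambda>j. (Suc j, Suc j)) ` {..<?r}. (g \<circ> \<sigma>) i p)"
      unfolding spherical_sum_def
    proof (rule sum.mono_neutral_right[OF finite_disc_indices])
      show "(\<lambda>j. (Suc j, Suc j)) ` {..<?r} \<subseteq> disc_indices R" using mem by blast
      show "\<forall>i\<in>disc_indices R - (\<lambda>j. (Suc j, Suc j)) ` {..<?r}. (g \<circ> \<sigma>) i p = 0"
      proof
        fix i assume i: "i \<in> disc_indices R - (\<lambda>j. (Suc j, Suc j)) ` {..<?r}"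
        then have "i \<in> pos_pairs" by (auto simp: disc_indices_def)
        moreover have "i \<notin> D" using i mem by (auto simp: D_def)
        ultimately show "(g \<circ> \<sigma>) i p = 0" by (rule off)
      qed
    qed
    also have "\<dots> = (\<Sum>j<?r. g (\<tau> j) p)"
      by (subst sum.reindex) (auto simp: inj_on_def diag[unfolded comp_apply] intro!: sum.cong)
    finally show ?thesis .
  qed
  show ?thesis using that[OF bij rect sph] .
qed

lemma weighted_L1_diagonal:
  assumes rect: "\<And>n m p. rect_sum h (n, m) p = (\<Sum>j<min n m. u j p)"
    and sph: "\<And>R p. spherical_sum h R p = (\<Sum>j<nat \<lfloor>\<bar>R\<bar> / sqrt 2\<rfloor>. u j p)"
    and lim: "tendsto_weighted_L1 \<mu> (\<lambda>n p. \<Sum>j<n. u j p) f sequentially"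
  shows "tendsto_weighted_L1 \<mu> (spherical_sum h) f at_top"
    "tendsto_weighted_L1 \<mu> (rect_sum h) f (sequentially \<times>\<^sub>F sequentially)"
proof -
  have "filterlim (\<lambda>R::real. nat \<lfloor>\<bar>R\<bar> / sqrt 2\<rfloor>) sequentially at_top"
  proof (rule filterlim_compose[OF filterlim_nat_sequentially filterlim_compose[OF filterlim_floor_sequentially]])
    have "filterlim (\<lambda>R::real. R * (1 / sqrt 2)) at_top at_top"
      by (rule filterlim_at_top_mult_tendsto_pos[OF tendsto_const _ filterlim_ident]) simp
    then have "filterlim (\<lambda>R::real. R / sqrt 2) at_top at_top" by simp
    then show "filterlim (\<lambda>R::real. \<bar>R\<bar> / sqrt 2) at_top at_top"
      by (rule filterlim_at_top_mono) (auto intro!: always_eventually divide_right_mono)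
  qed
  from filterlim_compose[OF lim[unfolded tendsto_weighted_L1_def] this]
  show "tendsto_weighted_L1 \<mu> (spherical_sum h) f at_top"
    by (simp add: tendsto_weighted_L1_def sph)
  have "filterlim (\<lambda>(n::nat, m). min n m) sequentially (sequentially \<times>\<^sub>F sequentially)"
    unfolding filterlim_at_top
  proof
    fix Z :: nat
    show "\<forall>\<^sub>F x in sequentially \<times>\<^sub>F sequentially. Z \<le> (case x of (n, m) \<Rightarrow> min n m)"
      unfolding eventually_prod_filter
      by (intro exI[of _ "\<lambda>n. Z \<le> n"]) (auto simp: eventually_ge_at_top)
  qed
  from filterlim_compose[OF lim[unfolded tendsto_weighted_L1_def] this]
  have "((\<lambda>x. \<integral>\<^sup>+ p. ennreal (cmod ((\<Sum>j<(case x of (n, m) \<Rightarrow> min n m). u j p) - of_real (f p)) * \<mu> p) \<partial>lebesgue_on unit_square) \<longlongrightarrow> 0)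
    (sequentially \<times>\<^sub>F sequentially)" .
  moreover have "(\<Sum>j<(case x of (n, m) \<Rightarrow> min n m). u j p) = rect_sum h x p" for x p
    by (cases x) (simp add: rect)
  ultimately show "tendsto_weighted_L1 \<mu> (rect_sum h) f (sequentially \<times>\<^sub>F sequentially)"
    by (simp add: tendsto_weighted_L1_def)
qed

section \<open>The sequence of blocks\<close>

lemma sum_list_apply: "(\<Sum>x\<leftarrow>xs. f x) p = (\<Sum>x\<leftarrow>xs. f x p)" for f :: "'a \<Rightarrow> 'b \<Rightarrow> 'c::comm_monoid_add"
  by (induction xs) auto

lemma sum_apply: "(\<Sum>x\<in>A. f x) p = (\<Sum>x\<in>A. f x p)" for f :: "'a \<Rightarrow> 'b \<Rightarrow> 'c::comm_monoid_add"
  by (induction A rule: infinite_finite_induct) auto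

text \<open>The enumeration \<open>from_nat\<close> of pairs (level, table) lists all candidates for the approximation.\<close>

definition target :: "nat \<Rightarrow> nat \<Rightarrow> real \<times> real \<Rightarrow> complex" where
  "target a k p = (case from_nat k of (n, l) \<Rightarrow> lattice_table n l (cell2 a n p))"

lemma target_measurable [measurable]: "target a k \<in> borel_measurable borel"
  unfolding target_def by (cases "from_nat k :: nat \<times> (int \<times> int) list list") simp

lemma target_bounded:
  assumes a: "2 \<le> a"
  shows "\<exists>b. \<forall>p. cmod (target a k p) \<le> b"
proof -
  obtain n :: nat and l :: "(int \<times> int) list list" where k: "from_nat k = (n, l)" by (rule prod.exhaust)
  let ?S = "{..<a ^ n} \<times> {..<a ^ n}"
  have "cmod (target a k p) \<le> (\<Sum>c\<in>?S. cmod (lattice_table n l c))" for p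
  proof -
    have "cell2 a n p \<in> ?S" using cell_less[OF a] by (simp add: cell2_def)
    then show ?thesis
      using member_le_sum[of "cell2 a n p" ?S "\<lambda>c. cmod (lattice_table n l c)"] by (simp add: target_def k)
  qed
  then show ?thesis by blast
qed

text \<open>Different levels have different codes, so the good approximations have arbitrarily large codes.\<close>

lemma targets_dense:
  assumes a: "2 \<le> a" and \<mu>: "is_weight \<mu>" and v: "v \<in> wspace \<mu>" and \<delta>: "0 < \<delta>"
  obtains k where "K \<le> k" "wnorm \<mu> (\<lambda>p. target a k p - v p) < \<delta>"
proof -
  obtain n0 where "\<forall>n\<ge>n0. \<exists>l. wnorm \<mu> (\<lambda>p. lattice_table n l (cell2 a n p) - v p) < \<delta>"
    using lattice_dense[OF a \<mu> v \<delta>] by blast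
  then obtain l where l: "\<And>n. n0 \<le> n \<Longrightarrow> wnorm \<mu> (\<lambda>p. lattice_table n (l n) (cell2 a n p) - v p) < \<delta>"
    by metis
  define f where "f n = to_nat (n, l n)" for n
  have "inj_on f {n0..}" by (auto simp: inj_on_def f_def)
  then have "infinite (f ` {n0..})" using finite_imageD infinite_Ici by blast
  then obtain k where k: "k \<in> f ` {n0..}" "K \<le> k" unfolding infinite_nat_iff_unbounded_le by blast
  then obtain n where "n0 \<le> n" "k = f n" by auto
  then have "wnorm \<mu> (\<lambda>p. target a k p - v p) < \<delta>" using l[of n] by (simp add: target_def f_def)
  then show ?thesis using that k(2) by blast
qed

text \<open>The exponent \<open>2 + 2\<^sup>-\<^sup>k\<close> decreases to 2, so for every \<open>q > 2\<close> all but finitely many blocks contribute at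
most \<open>2\<^sup>-\<^sup>k\<close> to the sum of the \<open>q\<close>-th powers.\<close>

definition is_block :: "nat \<Rightarrow> nat \<Rightarrow> ((nat \<times> nat) \<times> complex) list \<Rightarrow> (real \<times> real) set \<Rightarrow> bool" where
  "is_block a k ls B \<longleftrightarrow> distinct (map fst ls) \<and>
    (\<Sum>(i, z)\<leftarrow>ls. cmod z powr (2 + (1/2) ^ k)) \<le> (1/2) ^ k \<and>
    B \<in> sets borel \<and> measure LM (B \<inter> unit_square) \<le> (1/2) ^ k \<and>
    (\<forall>p. p \<notin> B \<longrightarrow> wpoly a ls p = target a k p) \<and>
    (\<forall>n. \<exists>R. integrable LM R \<and> (LINT p|LM. cmod (R p)) \<le> (1/2) ^ k \<and>
      (\<forall>p. p \<notin> B \<longrightarrow> cmod (wpoly a (take n ls) p) \<le> cmod (target a k p) + cmod (R p)))"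

lemma block_exists:
  assumes a: "2 \<le> a" and N: "1 \<le> N"
  shows "\<exists>ls B. is_block a k ls B \<and> fst ` set ls \<subseteq> {N..} \<times> {N..}"
proof -
  obtain n :: nat and l :: "(int \<times> int) list list" where k: "from_nat k = (n, l)" by (rule prod.exhaust)
  have d: "0 < (1/2::real) ^ k" by simp
  have t: "target a k p = lattice_table n l (cell2 a n p)" for p by (simp add: target_def k)
  show ?thesis
  proof (rule step_block[where g="lattice_table n l" and m=n, OF a N d], goal_cases)
    case (1 ls B)
    have "is_block a k ls B"
      unfolding is_block_def t
      using 1(1,3-5) by (intro conjI allI impI 1(6) 1(7)) assumption+
    then show ?case using 1(2) by blast
  qed
qed

text \<open>The first coordinates of successive blocks increase, which makes the blocks disjoint. They start at
\<open>k + 2\<close>: this leaves the column of first coordinate 1 to the zero coefficients, and it makes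
every finite set of indices disjoint from almost all blocks.\<close>

lemma block_sequence:
  assumes a: "2 \<le> a"
  shows "\<exists>ls B. (\<forall>k. is_block a k (ls k) (B k)) \<and> (\<forall>k. fst ` set (ls k) \<subseteq> {k + 2..} \<times> {1..}) \<and>
    (\<forall>j k. j \<noteq> k \<longrightarrow> fst ` set (ls j) \<inter> fst ` set (ls k) = {})"
proof -
  define P where "P k x \<longleftrightarrow> (case x of (ls, B, M :: nat) \<Rightarrow> is_block a k ls B \<and> fst ` set ls \<subseteq> {k + 2..} \<times> {1..} \<and> (\<forall>i\<in>fst ` set ls. fst i < M))" for k x
  define Q where "Q x y \<longleftrightarrow> (case x of (ls :: ((nat \<times> nat) \<times> complex) list, B :: (real \<times> real) set, M :: nat) \<Rightarrow> case y of (ls' :: ((nat \<times> nat) \<times> complex) list, B' :: (real \<times> real) set, M' :: nat) \<Rightarrow> M \<le> M' \<and> (\<forall>i\<in>fst ` set ls'. M \<le> fst i))" for x y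
  have ex: "\<exists>y. P k y \<and> (\<forall>i\<in>fst ` set (fst y). M \<le> fst i) \<and> M \<le> snd (snd y)" for k M
  proof -
    have "1 \<le> k + 2 + M" by simp
    from block_exists[OF a this, of k] obtain ls B where 1: "is_block a k ls B" "fst ` set ls \<subseteq> {k + 2 + M..} \<times> {k + 2 + M..}" by blast
    define M' where "M' = M + Suc (\<Sum>i\<in>fst ` set ls. fst i)"
    have lt: "fst i < M'" if "i \<in> fst ` set ls" for i
      using member_le_sum[OF that, of fst] by (simp add: M'_def)
    have "i \<in> {k + 2..} \<times> {1..}" and ge: "M \<le> fst i" if "i \<in> fst ` set ls" for i
      using subsetD[OF 1(2) that] by (auto simp: mem_Times_iff)
    then have "fst ` set ls \<subseteq> {k + 2..} \<times> {1..}" by blast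
    then have "P k (ls, B, M')"
      unfolding P_def prod.case using 1(1) lt by (intro conjI ballI) assumption+
    moreover have "M \<le> M'" by (simp add: M'_def)
    ultimately have "P k (ls, B, M') \<and> (\<forall>i\<in>fst ` set ls. M \<le> fst i) \<and> M \<le> M'"
      using ge by blast
    then show ?thesis by (intro exI[of _ "(ls, B, M')"]) simp
  qed
  have "\<exists>x. \<forall>k. P k (x k) \<and> Q (x k) (x (Suc k))"
  proof (rule dependent_nat_choice)
    show "\<exists>x. P 0 x" using ex[of 0 0] by blast
    show "\<exists>y. P (Suc k) y \<and> Q x y" if "P k x" for x k
    proof -
      obtain ls B M where x: "x = (ls, B, M)" by (cases x)
      obtain y where "P (Suc k) y" "\<forall>i\<in>fst ` set (fst y). M \<le> fst i" "M \<le> snd (snd y)" using ex[of "Suc k" M] by blast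
      then show ?thesis unfolding Q_def x by (intro exI[of _ y]) (cases y, simp)
    qed
  qed
  then obtain x where x: "\<And>k. P k (x k)" "\<And>k. Q (x k) (x (Suc k))" by blast
  define ls where "ls k = fst (x k)" for k
  define B where "B k = fst (snd (x k))" for k
  define M where "M k = snd (snd (x k))" for k
  have xk: "x k = (ls k, B k, M k)" for k by (simp add: ls_def B_def M_def)
  have 1: "is_block a k (ls k) (B k)" "fst ` set (ls k) \<subseteq> {k + 2..} \<times> {1..}" "\<And>i. i \<in> fst ` set (ls k) \<Longrightarrow> fst i < M k" for k
    using x(1)[of k] unfolding P_def xk by auto
  have 2: "M k \<le> M (Suc k)" "\<And>i. i \<in> fst ` set (ls (Suc k)) \<Longrightarrow> M k \<le> fst i" for k
    using x(2)[of k] unfolding Q_def xk by auto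
  have mono: "M j \<le> M k" if "j \<le> k" for j k
    using that 2(1) by (rule lift_Suc_mono_le[rotated])
  have less: "fst ` set (ls j) \<inter> fst ` set (ls k) = {}" if jk: "j < k" for j k
  proof -
    obtain k' where k': "k = Suc k'" "j \<le> k'" using jk by (cases k) auto
    have "i \<notin> fst ` set (ls k)" if "i \<in> fst ` set (ls j)" for i
      using 1(3)[OF that] mono[OF k'(2)] 2(2)[of i k'] by (auto simp: k'(1))
    then show ?thesis by blast
  qed
  have "fst ` set (ls j) \<inter> fst ` set (ls k) = {}" if "j \<noteq> k" for j k
    using less[of j k] less[of k j] that by (auto simp: neq_iff)
  then show ?thesis using 1(1,2) by (intro exI[of _ ls] exI[of _ B]) simp
qed

text \<open>Off the exceptional set the estimates of the block apply and the weight is at most 1; on the exceptional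
set the weight makes everything smaller than \<open>2\<^sup>-\<^sup>k\<close>.\<close>

lemma block_weighted:
  assumes a: "2 \<le> a" and \<mu>: "is_weight \<mu>" and b: "is_block a k ls B"
    and D: "\<And>p n. cmod (wpoly a (take n ls) p) \<le> D" "\<And>p. cmod (wpoly a ls p - target a k p) \<le> D"
    and small: "AE p in LM. p \<in> B \<longrightarrow> D * \<mu> p \<le> (1/2) ^ k"
  shows "wnorm \<mu> (\<lambda>p. wpoly a ls p - target a k p) \<le> (1/2) ^ k"
    "wnorm \<mu> (wpoly a (take n ls)) \<le> wnorm \<mu> (target a k) + 2 * (1/2) ^ k"
proof -
  note b' = b[unfolded is_block_def]
  have U: "AE p in LM. p \<in> unit_square" by (rule AE_I2) simp
  have m: "wpoly a l \<in> borel_measurable LM" "target a k \<in> borel_measurable LM" for l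
    by (rule borel_LM, measurable)+
  have ic: "integrable LM (\<lambda>p. (1/2::real) ^ k)" by (intro integrable_LM_bounded) auto
  obtain c where c: "\<And>p. cmod (target a k p) \<le> c" using target_bounded[OF a] by blast
  have tw: "target a k \<in> wspace \<mu>" by (rule wspace_bounded[OF \<mu> m(2) c])
  have "AE p in LM. cmod (wpoly a ls p - target a k p) * \<mu> p \<le> (1/2) ^ k"
    using small U
  proof eventually_elim
    case (elim p)
    have "0 \<le> \<mu> p" using weightD(2)[OF \<mu>, of p] elim by simp
    show ?case
    proof (cases "p \<in> B")
      case True
      have "cmod (wpoly a ls p - target a k p) * \<mu> p \<le> D * \<mu> p" using D(2) \<open>0 \<le> \<mu> p\<close> by (rule mult_right_mono)
      then show ?thesis using elim True by simp
    next
      case False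
      then have "wpoly a ls p = target a k p" using b' by blast
      then show ?thesis by simp
    qed
  qed
  from wspace_dominated(2)[OF \<mu> borel_measurable_diff[OF m] ic this]
  show "wnorm \<mu> (\<lambda>p. wpoly a ls p - target a k p) \<le> (1/2) ^ k"
    using measure_LM_space by simp
  obtain R where R: "integrable LM R" "(LINT p|LM. cmod (R p)) \<le> (1/2) ^ k"
    "\<And>p. p \<notin> B \<Longrightarrow> cmod (wpoly a (take n ls) p) \<le> cmod (target a k p) + cmod (R p)"
    using b' by blast
  let ?h = "\<lambda>p. cmod (target a k p) * \<mu> p + (cmod (R p) + (1/2) ^ k)"
  have "AE p in LM. cmod (wpoly a (take n ls) p) * \<mu> p \<le> ?h p"
    using small U
  proof eventually_elim
    case (elim p)
    have \<mu>p: "0 \<le> \<mu> p" "\<mu> p \<le> 1" using weightD(2,3)[OF \<mu>, of p] elim by simp_all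
    have t0: "0 \<le> cmod (target a k p) * \<mu> p" using \<mu>p by simp
    show ?case
    proof (cases "p \<in> B")
      case True
      have "cmod (wpoly a (take n ls) p) * \<mu> p \<le> D * \<mu> p" using D(1) \<mu>p(1) by (rule mult_right_mono)
      then show ?thesis using elim True t0 norm_ge_zero[of "R p"] by linarith
    next
      case False
      have "cmod (wpoly a (take n ls) p) * \<mu> p \<le> (cmod (target a k p) + cmod (R p)) * \<mu> p"
        using R(3)[OF False] \<mu>p(1) by (rule mult_right_mono)
      also have "\<dots> \<le> cmod (target a k p) * \<mu> p + cmod (R p) * 1"
        using \<mu>p by (simp add: distrib_right mult_left_le)
      also have "\<dots> \<le> ?h p" by simp
      finally show ?thesis .
    qed
  qed
  moreover have ih: "integrable LM ?h" using tw R(1) ic by (simp add: wspace_def)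
  ultimately have "wnorm \<mu> (wpoly a (take n ls)) \<le> (LINT p|LM. ?h p)"
    using wspace_dominated(2)[OF \<mu> m(1)] by blast
  also have "\<dots> = wnorm \<mu> (target a k) + ((LINT p|LM. cmod (R p)) + (1/2) ^ k)"
    using tw R(1) ic measure_LM_space by (simp add: wspace_def wnorm_def)
  also have "\<dots> \<le> wnorm \<mu> (target a k) + 2 * (1/2) ^ k" using R(2) by simp
  finally show "wnorm \<mu> (wpoly a (take n ls)) \<le> wnorm \<mu> (target a k) + 2 * (1/2) ^ k" .
qed

lemma walsh_term_eq: "walsh_term a c i p = c i * dwalsh a i p"
  by (cases i; cases p) (simp add: walsh_term_def dwalsh_def)

section \<open>The universal series\<close>

lemma sum_list_norm_take: "(\<Sum>(i, z)\<leftarrow>take n ls. cmod z) \<le> (\<Sum>(i, z)\<leftarrow>ls. cmod z)"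
proof -
  have "(\<Sum>(i, z)\<leftarrow>take n ls @ drop n ls. cmod z) = (\<Sum>(i, z)\<leftarrow>take n ls. cmod z) + (\<Sum>(i, z)\<leftarrow>drop n ls. cmod z)"
    by (simp del: append_take_drop_id)
  moreover have "0 \<le> (\<Sum>(i, z)\<leftarrow>drop n ls. cmod z)" by (rule sum_list_nonneg) auto
  ultimately show ?thesis by simp
qed

lemma block_norm_bound:
  assumes a: "2 \<le> a"
  shows "\<exists>D. 0 \<le> D \<and> (\<forall>p n. cmod (wpoly a (take n ls) p) \<le> D) \<and> (\<forall>p. cmod (wpoly a ls p - target a k p) \<le> D)"
proof -
  obtain c where c: "\<And>p. cmod (target a k p) \<le> c" using target_bounded[OF a] by blast
  let ?s = "\<Sum>(i, z)\<leftarrow>ls. cmod z"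
  have c0: "0 \<le> c" using c[of undefined] norm_ge_zero order_trans by blast
  have s0: "0 \<le> ?s" by (rule sum_list_nonneg) auto
  have w: "cmod (wpoly a (take n ls) p) \<le> ?s" for n p
    using norm_wpoly[OF a] sum_list_norm_take by (rule order_trans)
  have "cmod (wpoly a (take n ls) p) \<le> ?s + c" for n p using w[of n p] c0 by linarith
  moreover have "cmod (wpoly a ls p - target a k p) \<le> ?s + c" for p
    using w[of "length ls" p] c[of p] norm_triangle_ineq4[of "wpoly a ls p" "target a k p"] by simp
  ultimately show ?thesis using c0 s0 by (intro exI[of _ "?s + c"]) auto
qed

lemma wspace_of_weighted_L1:
  assumes \<mu>: "is_weight \<mu>" and f: "f \<in> weighted_L1 \<mu>"
  shows "(\<lambda>p. complex_of_real (f p)) \<in> wspace \<mu>"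
proof -
  have m: "f \<in> borel_measurable LM" and fin: "(\<integral>\<^sup>+ p. ennreal (\<bar>f p\<bar> * \<mu> p) \<partial>LM) < \<infinity>"
    using f by (auto simp: weighted_L1_def)
  have "integrable LM (\<lambda>p. \<bar>f p\<bar> * \<mu> p)"
    using m weightD(1,2)[OF \<mu>] fin by (intro integrableI_nonneg) (auto intro!: AE_I2 simp: less_imp_le)
  then show ?thesis using m by (simp add: wspace_def)
qed

lemma tendsto_weighted_L1_wnorm:
  assumes \<mu>: "is_weight \<mu>" and g: "\<And>n. (\<lambda>p. g n p - complex_of_real (f p)) \<in> wspace \<mu>"
    and lim: "(\<lambda>n. wnorm \<mu> (\<lambda>p. g n p - complex_of_real (f p))) \<longlonglongrightarrow> 0"
  shows "tendsto_weighted_L1 \<mu> g f sequentially"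
proof -
  have "(\<integral>\<^sup>+ p. ennreal (cmod (g n p - complex_of_real (f p)) * \<mu> p) \<partial>LM) = ennreal (wnorm \<mu> (\<lambda>p. g n p - complex_of_real (f p)))" for n
    unfolding wnorm_def using g[of n] weightD(2)[OF \<mu>]
    by (intro nn_integral_eq_integral) (auto intro!: AE_I2 simp: wspace_def less_imp_le)
  then show ?thesis using tendsto_ennrealI[OF lim] by (simp add: tendsto_weighted_L1_def)
qed

theorem theorem3p2:
  fixes a :: nat
  assumes "2 \<le> a"
  shows "\<exists>c :: nat \<times> nat \<Rightarrow> complex.
    (\<forall>q::real. 2 < q \<longrightarrow> (\<lambda>i. cmod (c i) powr q) summable_on pos_pairs) \<and>
    (\<forall>\<epsilon>::real. 0 < \<epsilon> \<longrightarrow>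
      (\<exists>\<mu> :: real \<times> real \<Rightarrow> real.
        \<mu> \<in> borel_measurable (lebesgue_on unit_square) \<and>
        (\<forall>p \<in> unit_square. 0 < \<mu> p \<and> \<mu> p \<le> 1) \<and>
        measure lebesgue {p \<in> unit_square. \<mu> p \<noteq> 1} < \<epsilon> \<and>
        universal_rearrangement \<mu> (walsh_term a c)))"
proof -
  note a = assms
  obtain ls B where blocks: "\<forall>k. is_block a k (ls k) (B k)" "\<forall>k. fst ` set (ls k) \<subseteq> {k + 2..} \<times> {1..}"
    "\<forall>j k. j \<noteq> k \<longrightarrow> fst ` set (ls j) \<inter> fst ` set (ls k) = {}"
    using block_sequence[OF a] by blast
  note blk = blocks(1)[rule_format] and sub = blocks(2)[rule_format] and disj = blocks(3)[rule_format]
  define X where "X k = fst ` set (ls k)" for k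
  have finX: "finite (X k)" for k by (simp add: X_def)
  have dist: "distinct (map fst (ls k))" for k using blk[of k] by (simp add: is_block_def)
  define c where "c i = (if \<exists>k. i \<in> X k then THE z. \<exists>k. (i, z) \<in> set (ls k) else 0)" for i
  have c_eq: "c i = z" if iz: "(i, z) \<in> set (ls k)" for i z k
  proof -
    have iX: "i \<in> X k" using iz by (force simp: X_def)
    have "z' = z" if iz': "(i, z') \<in> set (ls k')" for z' k'
    proof -
      have "i \<in> fst ` set (ls k')" using iz' by force
      then have "k' = k" using disj[of k' k] iX by (auto simp: X_def)
      then show ?thesis using eq_key_imp_eq_value[OF dist[of k] iz] iz' by simp
    qed
    then have "(THE z. \<exists>k. (i, z) \<in> set (ls k)) = z" using iz by blast
    then show ?thesis using iX by (auto simp: c_def)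
  qed
  have XK: "k + 2 \<le> fst i" if "i \<in> X k" for i k
    using subsetD[OF sub, of i k] that by (auto simp: X_def mem_Times_iff)
  have sumX: "(\<Sum>(i, z)\<leftarrow>ls k. F z) = (\<Sum>i\<in>X k. F (c i))" for F :: "complex \<Rightarrow> real" and k
  proof -
    have "(\<Sum>(i, z)\<leftarrow>ls k. F z) = (\<Sum>i\<leftarrow>map fst (ls k). F (c i))"
      unfolding map_map by (rule arg_cong[where f=sum_list], rule map_cong) (auto simp: c_eq)
    also have "\<dots> = (\<Sum>i\<in>X k. F (c i))"
      unfolding X_def set_map[symmetric] by (rule sum_list_distinct_conv_sum_set[OF dist])
    finally show ?thesis .
  qed
  have S1: "(\<Sum>i\<in>X k. cmod (c i) powr (2 + (1/2) ^ k)) \<le> (1/2) ^ k" for k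
    using blk[of k] sumX[of "\<lambda>z. cmod z powr (2 + (1/2) ^ k)" k] by (simp add: is_block_def)
  have c_powr: "cmod (c i) powr (2 + (1/2) ^ k) \<le> (1/2) ^ k" if "i \<in> X k" for i k
    using member_le_sum[OF that, of "\<lambda>i. cmod (c i) powr (2 + (1/2) ^ k)"] finX S1[of k] by fastforce
  have c1: "cmod (c i) \<le> 1" if "i \<in> X k" for i k
  proof (rule ccontr)
    assume "\<not> cmod (c i) \<le> 1"
    then have "1 < cmod (c i) powr (2 + (1/2) ^ k)" by (intro gr_one_powr) (auto intro: add_pos_pos)
    moreover have "(1/2::real) ^ k \<le> 1" by (simp add: power_le_one)
    ultimately show False using c_powr[OF that] by linarith
  qed
  have lim_half: "(\<lambda>n. (1/2::real) ^ n) \<longlonglongrightarrow> 0" by (rule LIMSEQ_realpow_zero) auto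
  have half: "\<exists>n. (1/2::real) ^ n < r" if "0 < r" for r
    using order_tendstoD(2)[OF lim_half that] by (auto dest: eventually_happens)
  have half_mono: "(1/2::real) ^ n \<le> (1/2) ^ m" if "m \<le> n" for m n
    using that by (intro power_decreasing) auto
  have summ: "(\<lambda>i. cmod (c i) powr q) summable_on pos_pairs" if q: "2 < q" for q
  proof -
    define b where "b k = (\<Sum>i\<in>X k. cmod (c i) powr q)" for k
    have b0: "0 \<le> b k" for k unfolding b_def by (intro sum_nonneg) simp
    obtain K where K: "(1/2) ^ K < q - 2" using half[of "q - 2"] q by auto
    have "norm (b k) \<le> (1/2) ^ k" if "K \<le> k" for k
    proof -
      have "2 + (1/2) ^ k \<le> q" using K half_mono[OF that] by linarith
      then have "b k \<le> (\<Sum>i\<in>X k. cmod (c i) powr (2 + (1/2) ^ k))"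
        unfolding b_def using c1 by (intro sum_mono powr_mono') auto
      then show ?thesis using S1[of k] b0[of k] by simp
    qed
    then have sb: "summable b"
      by (rule summable_comparison_test'[OF summable_geometric, rotated]) auto
    have "(\<Sum>i\<in>F. cmod (c i) powr q) \<le> suminf b" if F: "F \<subseteq> pos_pairs" "finite F" for F
    proof -
      \<comment> \<open>from \<open>K\<close> on the blocks lie beyond \<open>F\<close>\<close>
      define K where "K = Suc (\<Sum>i\<in>F. fst i)"
      have zero: "c i = 0" if i: "i \<in> F" "i \<notin> (\<Union>k<K. X k)" for i
      proof -
        have "fst i < K" using member_le_sum[OF i(1), of fst] F(2) by (simp add: K_def)
        then have "\<not> i \<in> X k" for k using i(2) XK[of i k] by auto
        then show ?thesis by (simp add: c_def)
      qed
      have "(\<Sum>i\<in>F. cmod (c i) powr q) = (\<Sum>i\<in>F \<inter> (\<Union>k<K. X k). cmod (c i) powr q)"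
        using F(2) zero by (intro sum.mono_neutral_right) auto
      also have "\<dots> \<le> (\<Sum>i\<in>(\<Union>k<K. X k). cmod (c i) powr q)"
        using finX by (intro sum_mono2) auto
      also have "\<dots> = (\<Sum>k<K. b k)"
        unfolding b_def using finX disj by (intro sum.UNION_disjoint) (auto simp: X_def)
      also have "\<dots> \<le> suminf b" using sb b0 by (intro sum_le_suminf) auto
      finally show ?thesis .
    qed
    then show ?thesis
      by (intro nonneg_bdd_above_summable_on) (auto intro!: bdd_aboveI[of _ "suminf b"])
  qed
  have cfin: "finite {i. r \<le> cmod (c i)}" if r: "0 < r" for r
  proof -
    \<comment> \<open>all exponents lie between 2 and 3, and powers of \<open>m \<le> 1\<close> decrease in the exponent\<close>
    define m where "m = min r 1"
    have m: "0 < m" "m \<le> 1" "m \<le> r" using r by (auto simp: m_def)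
    obtain K where K: "(1/2) ^ K < m powr 3" using half[of "m powr 3"] m by auto
    have "i \<in> (\<Union>k<K. X k)" if i: "r \<le> cmod (c i)" for i
    proof -
      have "c i \<noteq> 0" using i r by auto
      then obtain k where k: "i \<in> X k" by (auto simp: c_def split: if_splits)
      have "(1/2::real) ^ k \<le> 1" by (simp add: power_le_one)
      then have "m powr 3 \<le> m powr (2 + (1/2) ^ k)" using m by (intro powr_mono') auto
      also have "\<dots> \<le> cmod (c i) powr (2 + (1/2) ^ k)" using m i by (intro powr_mono2) auto
      also have "\<dots> \<le> (1/2) ^ k" by (rule c_powr[OF k])
      finally have "\<not> K \<le> k" using K half_mono[of K k] by linarith
      then show ?thesis using k by auto
    qed
    then have "{i. r \<le> cmod (c i)} \<subseteq> (\<Union>k<K. X k)" by auto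
    then show ?thesis by (rule finite_subset) (use finX in auto)
  qed
  have tsum: "(\<Sum>i\<leftarrow>take j (map fst (ls k)). walsh_term a c i) = wpoly a (take j (ls k))" for j k
  proof
    fix p
    have "walsh_term a c (fst x) p = (case x of (i, z) \<Rightarrow> z * dwalsh a i p)" if "x \<in> set (take j (ls k))" for x
    proof -
      obtain i z where x: "x = (i, z)" by (rule prod.exhaust)
      then have "(i, z) \<in> set (ls k)" using in_set_takeD[OF that] by simp
      from c_eq[OF this] show ?thesis by (simp add: x walsh_term_eq)
    qed
    then show "(\<Sum>i\<leftarrow>take j (map fst (ls k)). walsh_term a c i) p = wpoly a (take j (ls k)) p"
      unfolding sum_list_apply wpoly_def take_map map_map
      by (intro arg_cong[where f=sum_list] map_cong) auto
  qed
  define I where "I = {2::nat..} \<times> {1::nat..}"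
  have I: "I \<subseteq> pos_pairs" "infinite I" "infinite (pos_pairs - I)"
  proof -
    show "I \<subseteq> pos_pairs" by (auto simp: I_def pos_pairs_def)
    show "infinite I" unfolding I_def by (auto simp: finite_cartesian_product_iff infinite_Ici)
    have "pos_pairs - I = {1} \<times> {1..}" by (auto simp: I_def pos_pairs_def)
    then show "infinite (pos_pairs - I)" by (auto simp: finite_cartesian_product_iff infinite_Ici)
  qed
  have XI: "X k \<subseteq> I" for k
  proof
    fix i assume "i \<in> X k"
    then show "i \<in> I" using subsetD[OF sub, of i k] by (auto simp: X_def I_def mem_Times_iff)
  qed
  have "\<forall>k. \<exists>D. 0 \<le> D \<and> (\<forall>p n. cmod (wpoly a (take n (ls k)) p) \<le> D) \<and>
      (\<forall>p. cmod (wpoly a (ls k) p - target a k p) \<le> D)"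
    using block_norm_bound[OF a] by blast
  from choice[OF this] obtain D where
    "\<forall>k. 0 \<le> D k \<and> (\<forall>p n. cmod (wpoly a (take n (ls k)) p) \<le> D k) \<and>
      (\<forall>p. cmod (wpoly a (ls k) p - target a k p) \<le> D k)" by blast
  then have D: "\<And>k. 0 \<le> D k" "\<And>k p n. cmod (wpoly a (take n (ls k)) p) \<le> D k"
    "\<And>k p. cmod (wpoly a (ls k) p - target a k p) \<le> D k" by blast+
  have weighted: "\<exists>\<mu> :: real \<times> real \<Rightarrow> real. is_weight \<mu> \<and> measure lebesgue {p \<in> unit_square. \<mu> p \<noteq> 1} < \<epsilon> \<and>
      universal_rearrangement \<mu> (walsh_term a c)" if \<epsilon>: "0 < \<epsilon>" for \<epsilon>
  proof -
    have Bk: "B k \<in> sets borel" "measure LM (B k \<inter> unit_square) \<le> (1/2) ^ k" for k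
      using blk[of k] by (auto simp: is_block_def)
    obtain \<mu> K where \<mu>: "is_weight \<mu>" and small: "measure lebesgue {p \<in> unit_square. \<mu> p \<noteq> 1} < \<epsilon>"
      and bad: "\<forall>k\<ge>K. AE p in LM. p \<in> B k \<longrightarrow> D k * \<mu> p \<le> (1/2) ^ k"
      using weight_exists[of B D \<epsilon>, OF Bk D(1) \<epsilon>] by blast
    have tm: "walsh_term a c i \<in> borel_measurable LM" for i
    proof -
      have "walsh_term a c i = (\<lambda>p. c i * dwalsh a i p)" by (rule ext) (rule walsh_term_eq)
      then show ?thesis by (simp add: borel_LM)
    qed
    have tn: "cmod (walsh_term a c i p) = cmod (c i)" for i p
      by (simp add: walsh_term_eq norm_mult norm_dwalsh[OF a])
    have tw: "walsh_term a c i \<in> wspace \<mu>" for i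
      by (rule wspace_bounded[OF \<mu> tm, where b="cmod (c i)"]) (simp add: tn)
    have tle: "wnorm \<mu> (walsh_term a c i) \<le> cmod (c i)" for i
    proof -
      have ae: "AE p in LM. cmod (walsh_term a c i p) * \<mu> p \<le> cmod (c i)"
        using weightD(3)[OF \<mu>] by (intro AE_I2) (auto simp: tn intro: mult_left_le)
      have ic: "integrable LM (\<lambda>p. cmod (c i))" by (rule integrable_LM_bounded[where B="cmod (c i)"]) auto
      show ?thesis using wspace_dominated(2)[OF \<mu> tm ic ae] measure_LM_space by simp
    qed
    have univ: "\<exists>\<tau>. bij_betw \<tau> UNIV I \<and> (\<lambda>n. wnorm \<mu> ((\<Sum>j<n. walsh_term a c (\<tau> j)) - v)) \<longlonglongrightarrow> 0"
      if v: "v \<in> wspace \<mu>" for v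
    proof (rule rearrangement_of_blocks[where V="wspace \<mu>", OF I(2) tw _ _ _ _ _ _ _ _ _ v])
      show "0 \<in> wspace \<mu>" by (simp add: wspace_def zero_fun_def)
      show "wnorm \<mu> 0 = 0" by (simp add: wnorm_def)
      show "u + w \<in> wspace \<mu>" "wnorm \<mu> (u + w) \<le> wnorm \<mu> u + wnorm \<mu> w" if "u \<in> wspace \<mu>" "w \<in> wspace \<mu>" for u w
        using wspace_add[OF \<mu> that] by (simp_all add: plus_fun_def)
      show "- u \<in> wspace \<mu>" if "u \<in> wspace \<mu>" for u
        using wspace_neg(1)[OF that] by (simp add: fun_Compl_def)
      show "wnorm \<mu> (- u) = wnorm \<mu> u" for u by (simp add: wnorm_def)
      show "0 \<le> wnorm \<mu> u" for u by (rule wnorm_nonneg[OF \<mu>])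
      show "finite {i \<in> I. \<delta> \<le> wnorm \<mu> (walsh_term a c i)}" if "0 < \<delta>" for \<delta>
        by (rule finite_subset[OF _ cfin[OF that]]) (use tle order_trans in blast)
    next
      fix u and \<delta> :: real and A :: "(nat \<times> nat) set" assume u: "u \<in> wspace \<mu>" and \<delta>: "0 < \<delta>" and A: "finite A"
      obtain n where n: "(1/2) ^ n < \<delta> / 4" using half[of "\<delta> / 4"] \<delta> by auto
      have \<delta>2: "0 < \<delta> / 4" using \<delta> by simp
      \<comment> \<open>beyond \<open>K\<close> the weight controls block \<open>k\<close>; beyond \<open>n\<close> its errors are small; and beyond the sum of the first coordinates it avoids \<open>A\<close>\<close>
      obtain k where k: "K + n + (\<Sum>i\<in>A. fst i) \<le> k" "wnorm \<mu> (\<lambda>p. target a k p - u p) < \<delta> / 4"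
        by (rule targets_dense[OF a \<mu> u \<delta>2])
      have kn: "(1/2) ^ k < \<delta> / 4" using le_less_trans[OF half_mono[of n k] n] k(1) by simp
      have "X k \<inter> A = {}"
      proof -
        have "i \<notin> A" if "i \<in> X k" for i
          using member_le_sum[of i A fst] A XK[OF that] k(1) by auto
        then show ?thesis by blast
      qed
      then have l: "distinct (map fst (ls k))" "set (map fst (ls k)) \<subseteq> I - A"
        using dist XI[of k] by (auto simp: X_def)
      have bad': "AE p in LM. p \<in> B k \<longrightarrow> D k * \<mu> p \<le> (1/2) ^ k" using bad k(1) by simp
      note bw = block_weighted[OF a \<mu> blk[of k] D(2) D(3) bad']
      have wl: "wpoly a l \<in> wspace \<mu>" for l
        by (rule wspace_bounded[OF \<mu> _ norm_wpoly[OF a]], rule borel_LM, measurable)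
      obtain b where "\<And>p. cmod (target a k p) \<le> b" using target_bounded[OF a] by blast
      then have tgt: "target a k \<in> wspace \<mu>"
        by (intro wspace_bounded[OF \<mu>]) (auto intro: borel_LM)
      have "wnorm \<mu> (wpoly a (ls k) - u) \<le> \<delta>"
        using wspace_add(2)[OF \<mu> wspace_diff(1)[OF \<mu> wl tgt] wspace_diff(1)[OF \<mu> tgt u], of "ls k"] bw(1) k(2) kn \<delta>
        by (simp add: fun_diff_def)
      moreover have "wnorm \<mu> (wpoly a (take j (ls k))) \<le> wnorm \<mu> u + \<delta>" for j
        using wspace_add(2)[OF \<mu> wspace_diff(1)[OF \<mu> tgt u] u] bw(2)[of j] k(2) kn \<delta> by simp
      ultimately show "\<exists>l. distinct l \<and> set l \<subseteq> I - A \<and> wnorm \<mu> ((\<Sum>i\<leftarrow>l. walsh_term a c i) - u) \<le> \<delta> \<and>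
          (\<forall>j. wnorm \<mu> (\<Sum>i\<leftarrow>take j l. walsh_term a c i) \<le> wnorm \<mu> u + \<delta>)"
        using l tsum[of "length (ls k)" k] tsum[of _ k] by (intro exI[of _ "map fst (ls k)"]) simp
    qed
    have off: "walsh_term a c i p = 0" if "i \<in> pos_pairs - I" for i p
    proof -
      have "c i = 0" using that XI by (auto simp: c_def)
      then show ?thesis by (simp add: walsh_term_eq)
    qed
    have "universal_rearrangement \<mu> (walsh_term a c)"
      unfolding universal_rearrangement_def
    proof
      fix f assume f: "f \<in> weighted_L1 \<mu>"
      let ?v = "\<lambda>p. complex_of_real (f p)"
      have v: "?v \<in> wspace \<mu>" by (rule wspace_of_weighted_L1[OF \<mu> f])
      obtain \<tau> where \<tau>: "bij_betw \<tau> UNIV I" "(\<lambda>n. wnorm \<mu> ((\<Sum>j<n. walsh_term a c (\<tau> j)) - ?v)) \<longlonglongrightarrow> 0"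
        using univ[OF v] by blast
      have eq: "(\<Sum>j<n. walsh_term a c (\<tau> j)) - ?v = (\<lambda>p. (\<Sum>j<n. walsh_term a c (\<tau> j) p) - ?v p)" for n
        by (simp add: fun_eq_iff sum_apply)
      have "(\<lambda>p. \<Sum>j<n. walsh_term a c (\<tau> j) p) \<in> wspace \<mu>" for n
        by (rule wspace_bounded[OF \<mu> borel_measurable_sum[OF tm], of _ _ "\<Sum>j<n. cmod (c (\<tau> j))"]) (simp add: sum_norm_le tn)
      then have lim: "tendsto_weighted_L1 \<mu> (\<lambda>n p. \<Sum>j<n. walsh_term a c (\<tau> j) p) f sequentially"
        using \<tau>(2) unfolding eq by (intro tendsto_weighted_L1_wnorm[OF \<mu>] wspace_diff(1)[OF \<mu> _ v])
      obtain \<sigma> where \<sigma>: "bij_betw \<sigma> pos_pairs pos_pairs"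
        "\<And>n m p. rect_sum (walsh_term a c \<circ> \<sigma>) (n, m) p = (\<Sum>j<min n m. walsh_term a c (\<tau> j) p)"
        "\<And>R p. spherical_sum (walsh_term a c \<circ> \<sigma>) R p = (\<Sum>j<nat \<lfloor>\<bar>R\<bar> / sqrt 2\<rfloor>. walsh_term a c (\<tau> j) p)"
        using diagonal_rearrangement[OF I(1,3) \<tau>(1), of "walsh_term a c"] off by blast
      show "\<exists>\<sigma>. bij_betw \<sigma> pos_pairs pos_pairs \<and>
          tendsto_weighted_L1 \<mu> (spherical_sum (walsh_term a c \<circ> \<sigma>)) f at_top \<and>
          tendsto_weighted_L1 \<mu> (rect_sum (walsh_term a c \<circ> \<sigma>)) f (sequentially \<times>\<^sub>F sequentially)"
        using \<sigma>(1) weighted_L1_diagonal[OF \<sigma>(2,3) lim] by blast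
    qed
    then show ?thesis using \<mu> small by blast
  qed
  show ?thesis
    using summ weighted unfolding is_weight_def by (intro exI[of _ c]) blast
qed

end
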